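(* Let $d\ge 1$, $n\ge 2$, and let $p(\cdot)$ be a finite range, irreducible, symmetric transition probability on $\mathbb{Z}^d$. There exist finite constants $C_2=C_2(n,d,p)$ and $a_0=a_0(p)$ such that the following holds. Let $A_0=\{z_1,\dots,z_n\}\in\mathcal{E}_n$, let $\mathbf z=(z_1,\dots,z_n)$, and let $f_t$ be the solution of the forward equation $\partial_t f_t=\mathcal{L}_n f_t$ with initial condition $f_0(A)=\mathbf{1}\{A=A_0\}$. Then $$ f_T(A)\;\le\;\sum_{\sigma}\frac{C_2}{(1+T)^{nd/2}}\exp\Big\{-\frac{a_0T}{2(\log T)^2}\,\Phi\Big(\frac{\Vert \mathbf x_\sigma-\mathbf z\Vert\,\log T}{a_0^2\,T}\Big)\Big\} $$ for every $T>C_2$ and every set $A=\{x_1,\dots,x_n\}\in\mathcal{E}_n$, where the sum is over all permutations $\sigma$ of $\{1,\dots,n\}$ and $\mathbf x_\sigma=(x_{\sigma(1)},\dots,x_{\sigma(n)})$.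
   Context: $\mathcal{E}_n=\{A\subset\mathbb{Z}^d: |A|=n\}$. The generator $\mathcal{L}_n$ of $n$ indistinguishable symmetric exclusion particles acts on functions $f:\mathcal{E}_n\to\mathbb{R}$ by $$(\mathcal{L}_nf)(A)=\sum_{\{x,y\}} p(y-x)\,[f(A_{x,y})-f(A)],$$ where the sum is over all bonds, i.e. unordered pairs $\{x,y\}$ of distinct sites of $\mathbb{Z}^d$ (each pair counted once), and $A_{x,y}$ is the set $A$ with the sites $x,y$ exchanged: $A_{x,y}=(A\setminus\{x\})\cup\{y\}$ if $x\in A,\,y\notin A$; $A_{x,y}=(A\setminus\{y\})\cup\{x\}$ if $y\in A,\,x\notin A$; $A_{x,y}=A$ otherwise. "Symmetric" means $p(-x)=p(x)$; "finite range" means that $p$ has finite support; "irreducible" means that the random walk on $\mathbb{Z}^d$ with jump law $p$ is irreducible. $\Vert\cdot\Vert$ is the Euclidean norm on $(\mathbb{R}^d)^n$. $\Phi$ is the Legendre transform of the convex function $w\mapsto w^2\cosh w$: $\Phi(u)=\sup_{w\in\mathbb{R}}\{uw-w^2\cosh w\}$. *)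

theory Defs
  imports "HOL-Probability.Probability"
begin

text \<open>
  A transition probability on $\mathbb{Z}^d$ is a \<^typ>\<open>(int ^ 'd) pmf\<close>, the law of one jump.
\<close>

definition finite_range :: "'a pmf \<Rightarrow> bool" where
  "finite_range p \<longleftrightarrow> finite (set_pmf p)"

definition symmetric_law :: "'a::ab_group_add pmf \<Rightarrow> bool" where
  "symmetric_law p \<longleftrightarrow> (\<forall>x. pmf p (- x) = pmf p x)"

primrec walk :: "'a::ab_group_add pmf \<Rightarrow> 'a \<Rightarrow> nat \<Rightarrow> 'a pmf" where
  "walk p x 0 = return_pmf x"
| "walk p x (Suc k) = bind_pmf (walk p x k) (\<lambda>u. map_pmf (\<lambda>v. u + v) p)"

definition irreducible_walk :: "'a::ab_group_add pmf \<Rightarrow> bool" where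
  "irreducible_walk p \<longleftrightarrow> (\<forall>x y. \<exists>k. pmf (walk p x k) y > 0)"

definition configs :: "nat \<Rightarrow> 'a set set" where
  "configs n = {A. finite A \<and> card A = n}"

definition exchange :: "'a \<Rightarrow> 'a \<Rightarrow> 'a set \<Rightarrow> 'a set" where
  "exchange x y A =
    (if x \<in> A \<and> y \<notin> A then (A - {x}) \<union> {y}
     else if y \<in> A \<and> x \<notin> A then (A - {y}) \<union> {x}
     else A)"

lemma exchange_commute: "exchange x y A = exchange y x A"
  by (auto simp: exchange_def)

text \<open>
  The contribution of one bond (unordered pair). For symmetric \<open>p\<close> it does not depend on the
  labelling of the two end points, so the description below is proper; see \<open>bond_term_eq\<close>.
\<close>

definition bond_term ::
  "'a::ab_group_add pmf \<Rightarrow> ('a set \<Rightarrow> real) \<Rightarrow> 'a set \<Rightarrow> 'a set \<Rightarrow> real" where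
  "bond_term p f A b =
    (THE r. \<exists>x y. b = {x, y} \<and> r = pmf p (y - x) * (f (exchange x y A) - f A))"

definition bonds :: "'a set set" where
  "bonds = {{x, y} | x y. x \<noteq> y}"

text \<open>
  For symmetric \<open>p\<close> of finite range and finite \<open>A\<close>, only finitely many bonds contribute
  (\<open>finite_bond_terms\<close>), so the sum below is a finite sum.
\<close>

definition generator ::
  "'a::ab_group_add pmf \<Rightarrow> ('a set \<Rightarrow> real) \<Rightarrow> 'a set \<Rightarrow> real" where
  "generator p f A = (\<Sum>\<^sub>\<infinity>b\<in>bonds. bond_term p f A b)"

lemma bond_term_eq:
  assumes "symmetric_law p"
  shows "bond_term p f A {x, y} = pmf p (y - x) * (f (exchange x y A) - f A)"
proof -
  have "pmf p (x - y) = pmf p (y - x)"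
    using assms by (metis minus_diff_eq symmetric_law_def)
  then show ?thesis
    unfolding bond_term_def
    by (intro the_equality) (auto simp: doubleton_eq_iff exchange_commute)
qed

lemma finite_bond_terms:
  assumes sym: "symmetric_law p" and fin: "finite_range p" and A: "finite A"
  shows "finite {b \<in> bonds. bond_term p f A b \<noteq> 0}"
proof (rule finite_subset)
  show "finite ((\<lambda>(a, v). {a, a + v}) ` (A \<times> set_pmf p))"
    using fin A by (auto simp: finite_range_def)
  show "{b \<in> bonds. bond_term p f A b \<noteq> 0} \<subseteq> (\<lambda>(a, v). {a, a + v}) ` (A \<times> set_pmf p)"
  proof
    fix b assume "b \<in> {b \<in> bonds. bond_term p f A b \<noteq> 0}"
    then obtain x y where b: "b = {x, y}" "bond_term p f A {x, y} \<noteq> 0"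
      by (auto simp: bonds_def)
    then have nz: "pmf p (y - x) \<noteq> 0" "f (exchange x y A) \<noteq> f A"
      using bond_term_eq[OF sym, of f A x y] by auto
    then have nz': "pmf p (x - y) \<noteq> 0"
      using sym by (metis minus_diff_eq symmetric_law_def)
    have "x \<in> A \<or> y \<in> A"
      using nz(2) by (auto simp: exchange_def split: if_splits)
    then show "b \<in> (\<lambda>(a, v). {a, a + v}) ` (A \<times> set_pmf p)"
    proof
      assume "x \<in> A"
      then show ?thesis
        using nz(1) b by (intro image_eqI[of _ _ "(x, y - x)"]) (auto simp: set_pmf_iff)
    next
      assume "y \<in> A"
      then show ?thesis
        using nz' b by (intro image_eqI[of _ _ "(y, x - y)"]) (auto simp: set_pmf_iff)
    qed
  qed
qed

text \<open>
  On the infinite state space, the forward equation alone does not have a unique solution.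
  The last clause, boundedness locally uniformly in time, selects the solution: the generator
  is a bounded operator on bounded functions on \<open>configs n\<close>, so this solution exists, is unique
  and is the law at time \<open>t\<close> of the particle system started from \<open>A0\<close>. At \<open>t = 0\<close> the derivative
  is one-sided. Values of \<open>f t\<close> outside \<open>configs n\<close> are irrelevant, since \<open>exchange\<close> preserves
  cardinality.
\<close>

definition forward_solution ::
  "'a::ab_group_add pmf \<Rightarrow> nat \<Rightarrow> 'a set \<Rightarrow> (real \<Rightarrow> 'a set \<Rightarrow> real) \<Rightarrow> bool" where
  "forward_solution p n A0 f \<longleftrightarrow>
    (\<forall>A\<in>configs n. f 0 A = (if A = A0 then 1 else 0)) \<and>
    (\<forall>t\<ge>0. \<forall>A\<in>configs n.
      ((\<lambda>s. f s A) has_real_derivative generator p (f t) A) (at t within {0..})) \<and>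
    (\<forall>T\<ge>0. \<exists>M. \<forall>t\<in>{0..T}. \<forall>A\<in>configs n. \<bar>f t A\<bar> \<le> M)"

definition legendre :: "(real \<Rightarrow> real) \<Rightarrow> real \<Rightarrow> real" where
  "legendre g u = (SUP w. u * w - g w)"

definition Phi :: "real \<Rightarrow> real" where
  "Phi = legendre (\<lambda>w. w\<^sup>2 * cosh w)"

lemma Phi_bdd_above: "bdd_above (range (\<lambda>w. u * w - w\<^sup>2 * cosh w))" for u :: real
proof (rule bdd_aboveI2)
  fix w :: real
  have "w\<^sup>2 * 1 \<le> w\<^sup>2 * cosh w"
    by (intro mult_left_mono cosh_real_ge_1) auto
  moreover have "0 \<le> (w - u / 2)\<^sup>2"
    by simp
  ultimately show "u * w - w\<^sup>2 * cosh w \<le> u\<^sup>2 / 4"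
    by (simp add: power2_diff power_divide mult.commute)
qed

text \<open>
  The Euclidean norm $\Vert \mathbf{x} - \mathbf{z} \Vert$ on $(\mathbb{R}^d)^n$ of the difference
  of two \<open>n\<close>-tuples of sites, indexed by \<open>{1..n}\<close>.
\<close>

definition tuple_dist ::
  "nat \<Rightarrow> (nat \<Rightarrow> int ^ 'd) \<Rightarrow> (nat \<Rightarrow> int ^ 'd) \<Rightarrow> real" where
  "tuple_dist n x z =
    L2_set (\<lambda>i. norm ((\<chi> j. real_of_int (x i $ j) - real_of_int (z i $ j)) :: real ^ 'd)) {1..n}"

end

theory Submission
  imports Defs "HOL-Combinatorics.Cycles"
begin

text \<open>
  The bound reduces to a statement about one random walk, in three steps.

  First, exclusion particles are dominated by independent ones on product functions. If \<open>u t\<close> solves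
  the heat equation of a single particle with a nonnegative initial value that is supported on the initial
  configuration, then \<open>\<lambda>A. \<Prod>x\<in>A. u t x\<close> is a supersolution of the exclusion equation
  (\<open>generator_prod_le\<close>): the difference of the two generators is a sum of squares, by symmetry of
  \<open>p\<close>. The comparison principle then gives
  \<open>f T A * (\<Prod>i. g i) \<le> (\<Prod>j. \<Sum>i. g i * q T (x j - z i))\<close> for all positive weights \<open>g\<close>, where
  \<open>q\<close> is the heat kernel of the walk (\<open>exclusion_le_product\<close>).

  Second, the weights are optimized. For equal weights, expanding the product on the right gives a sum over all
  maps from particles to particles, and maps that are not injective can be much too large. The
  best weights come from the dual linear program of the assignment problem, and with
  them the right-hand side is at most a constant, depending on \<open>n\<close>, times the largest product
  \<open>\<Prod>i. q T (x (\<sigma> i) - z i)\<close> over permutations \<open>\<sigma>\<close>; more precisely, this is done for an upper bound of \<open>q\<close>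
  that never vanishes (\<open>capacity_le_permutation\<close>).

  Third, one needs \<open>q T v \<le> C * T powr (- d / 2) * exp (- (T / 2) * Phi (2 * norm v / (K * T)))\<close>,
  where \<open>K\<close> bounds the range of \<open>p\<close> (\<open>heat_kernel_bound\<close>). An exponential change of
  measure turns the walk into one with other jump rates and produces the exponential factor. The factor
  \<open>T powr (- d / 2)\<close> holds uniformly in the change of measure: irreducibility provides \<open>d\<close> linearly
  independent steps, the numbers of which are independent Poisson variables and are determined
  by their total displacement, and no Poisson weight of mean \<open>s\<close> exceeds \<open>exp 1 / sqrt s\<close>.

  Finally the one-particle exponents are added up (\<open>Phi_superadditive\<close>). Here \<open>a0 = K\<close> works for
  every \<open>n\<close>, because the optimal tilts of the particles can be taken proportional to their
  displacements, as for a single walk in dimension \<open>n * d\<close>.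
\<close>

section \<open>A comparison principle for bounded rates\<close>

text \<open>
  The minimum principle for a jump process with total jump rate at most \<open>c\<close>: such a generator
  sends a function that is at least \<open>- B\<close> everywhere to one that is at least \<open>- c * (B + k)\<close>, which
  is all that the hypothesis \<open>drift\<close> records. On an infinite state space the minimum need not be
  attained, so instead of looking at a minimizer one improves the lower bound repeatedly, as in a
  Picard iteration: a bound \<open>- M' * (c * t) ^ j / fact j\<close> for \<open>exp (c * t) * k t\<close> can be integrated
  in time to give the same bound with \<open>j + 1\<close>, and these bounds tend to \<open>0\<close>.
\<close>

lemma comparison_principle:
  fixes k :: "real \<Rightarrow> 'a \<Rightarrow> real"
  assumes c: "0 \<le> c"
    and init: "\<And>a. a \<in> S \<Longrightarrow> 0 \<le> k 0 a"
    and deriv: "\<And>t a. 0 \<le> t \<Longrightarrow> t \<le> T \<Longrightarrow> a \<in> S \<Longrightarrow>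
      ((\<lambda>s. k s a) has_real_derivative k' t a) (at t within {0..})"
    and bdd: "\<And>t a. 0 \<le> t \<Longrightarrow> t \<le> T \<Longrightarrow> a \<in> S \<Longrightarrow> - M \<le> k t a"
    and drift: "\<And>t a B. 0 \<le> t \<Longrightarrow> t \<le> T \<Longrightarrow> a \<in> S \<Longrightarrow> (\<And>b. b \<in> S \<Longrightarrow> - B \<le> k t b) \<Longrightarrow>
      - c * (B + k t a) \<le> k' t a"
    and t: "0 \<le> t" "t \<le> T" and a: "a \<in> S"
  shows "0 \<le> k t a"
proof -
  define M' where "M' = \<bar>M\<bar> * exp (c * T)"
  have iter: "- (M' * (c * t) ^ j / fact j) \<le> exp (c * t) * k t a"
    if "0 \<le> t" "t \<le> T" "a \<in> S" for j t a
    using that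
  proof (induction j arbitrary: t a)
    case 0
    have "exp (c * t) * (- k t a) \<le> exp (c * t) * \<bar>M\<bar>"
      using bdd[OF 0] by (intro mult_left_mono) auto
    also have "\<dots> \<le> exp (c * T) * \<bar>M\<bar>"
      using 0 c by (intro mult_right_mono) (auto intro: mult_left_mono)
    finally show ?case by (simp add: M'_def mult.commute)
  next
    case (Suc j)
    define h where "h s = exp (c * s) * k s a + M' * (c * s) ^ Suc j / fact (Suc j)" for s
    have dh: "(h has_real_derivative
        exp (c * s) * (c * k s a + k' s a) + c * (M' * (c * s) ^ j / fact j)) (at s within {0..})"
      if "0 \<le> s" "s \<le> T" for s
    proof -
      have "((\<lambda>s. M' * (c * s) ^ Suc j / fact (Suc j)) has_real_derivative
         M' * (real (Suc j) * (c * s) ^ j * c) / fact (Suc j)) (at s within {0..})"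
        by (rule DERIV_cdivide DERIV_cmult derivative_eq_intros refl)+ simp
      moreover have "M' * (real (Suc j) * (c * s) ^ j * c) / fact (Suc j) = c * (M' * (c * s) ^ j / fact j)"
        unfolding fact_Suc of_nat_mult
        by (simp add: divide_simps del: of_nat_Suc)
      ultimately have "((\<lambda>s. M' * (c * s) ^ Suc j / fact (Suc j)) has_real_derivative
         c * (M' * (c * s) ^ j / fact j)) (at s within {0..})" by (simp only:)
      moreover have "((\<lambda>s. exp (c * s) * k s a) has_real_derivative
          exp (c * s) * (c * k s a + k' s a)) (at s within {0..})"
        using deriv[OF that Suc.prems(3)]
        by (auto intro!: derivative_eq_intros simp: algebra_simps)
      ultimately show ?thesis
        unfolding h_def by (rule DERIV_add[rotated])
    qed
    have nonneg: "0 \<le> exp (c * s) * (c * k s a + k' s a) + c * (M' * (c * s) ^ j / fact j)"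
      if s: "0 \<le> s" "s \<le> T" for s
    proof -
      define B where "B = exp (- (c * s)) * (M' * (c * s) ^ j / fact j)"
      have "- B \<le> k s b" if "b \<in> S" for b
      proof -
        have "exp (- (c * s)) * - (M' * (c * s) ^ j / fact j) \<le> exp (- (c * s)) * (exp (c * s) * k s b)"
          using Suc.IH[OF s that] by (intro mult_left_mono) auto
        also have "\<dots> = k s b" by (simp add: exp_minus)
        finally show ?thesis by (simp add: B_def)
      qed
      then have "- c * (B + k s a) \<le> k' s a"
        using drift[OF s Suc.prems(3)] by blast
      then have "exp (c * s) * (- c * B) \<le> exp (c * s) * (c * k s a + k' s a)"
        by (intro mult_left_mono) (auto simp: algebra_simps)
      then have "0 \<le> exp (c * s) * (c * k s a + k' s a) + c * (exp (c * s) * B)"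
        by (simp add: algebra_simps)
      moreover have "exp (c * s) * B = M' * (c * s) ^ j / fact j"
        by (simp add: B_def exp_minus field_simps)
      ultimately show ?thesis
        by simp
    qed
    \<comment> \<open>the bound for \<open>j + 1\<close> is the statement that \<open>h\<close>, which starts nonnegative, is nondecreasing\<close>
    have "h 0 \<le> h t"
    proof (rule DERIV_nonneg_imp_increasing_open[OF Suc.prems(1)])
      fix s assume s: "0 < s" "s < t"
      then have "at s within {0..} = at s"
        by (intro at_within_interior) (auto simp: interior_real_atLeast)
      then show "\<exists>y. (h has_real_derivative y) (at s) \<and> 0 \<le> y"
        using dh[of s] nonneg[of s] s Suc.prems by (metis less_eq_real_def order.trans)
    next
      have "continuous_on {0..T} h"
        unfolding continuous_on_eq_continuous_within
        by (intro ballI continuous_within_subset[OF DERIV_continuous[OF dh]]) auto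
      then show "continuous_on {0..t} h"
        using Suc.prems by (auto intro: continuous_on_subset)
    qed
    moreover have "0 \<le> h 0"
      using init[OF Suc.prems(3)] by (simp add: h_def)
    ultimately have "0 \<le> h t" by simp
    then show ?case by (simp add: h_def)
  qed
  have "(\<lambda>j. - (M' * (c * t) ^ j / fact j)) \<longlonglongrightarrow> 0"
  proof -
    have "(\<lambda>j. (c * t) ^ j / fact j) \<longlonglongrightarrow> 0"
      using summable_LIMSEQ_zero[OF summable_exp[of "c * t"]] by (simp add: field_simps)
    then have "(\<lambda>j. - M' * ((c * t) ^ j / fact j)) \<longlonglongrightarrow> - M' * 0"
      by (intro tendsto_intros)
    then show ?thesis by simp
  qed
  then have "0 \<le> exp (c * t) * k t a"
    by (rule LIMSEQ_le_const2) (use iter[OF t a] in blast)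
  then show ?thesis
    by (simp add: zero_le_mult_iff)
qed

section \<open>Poisson weights\<close>

definition poisson_weight :: "nat \<Rightarrow> real \<Rightarrow> real" where
  "poisson_weight k s = exp (- s) * s ^ k / fact k"

lemma poisson_weight_nonneg: "0 \<le> s \<Longrightarrow> 0 \<le> poisson_weight k s"
  by (simp add: poisson_weight_def)

lemma poisson_weight_sums: "(\<lambda>k. poisson_weight k s) sums 1"
proof -
  have "(\<lambda>k. exp (- s) * (s ^ k /\<^sub>R fact k)) sums (exp (- s) * exp s)"
    by (intro sums_mult exp_converges)
  then show ?thesis
    by (simp add: poisson_weight_def divide_inverse mult_ac exp_minus)
qed

lemma abs_poisson_weight_le:
  assumes "\<bar>s\<bar> \<le> A"
  shows "\<bar>poisson_weight k s\<bar> \<le> exp A * (A ^ k / fact k)"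
proof -
  have "exp (- s) * (\<bar>s\<bar> ^ k / fact k) \<le> exp A * (A ^ k / fact k)"
    using assms by (intro mult_mono divide_right_mono power_mono) auto
  then show ?thesis
    by (simp add: poisson_weight_def abs_mult power_abs)
qed

lemma exp_series_sums: "(\<lambda>k. exp A * (A ^ k / fact k)) sums exp (2 * A :: real)"
proof -
  have "(\<lambda>k. exp A * (A ^ k /\<^sub>R fact k)) sums (exp A * exp A)"
    by (intro sums_mult exp_converges)
  then show ?thesis
    by (simp add: divide_inverse mult_ac flip: exp_add)
qed

text \<open>
  The weight of \<open>k - 1\<close>, and \<open>0\<close> for \<open>k = 0\<close> (truncated subtraction would repeat the weight of \<open>0\<close>).
\<close>

definition poisson_weight_pred :: "nat \<Rightarrow> real \<Rightarrow> real" where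
  "poisson_weight_pred k s = (case k of 0 \<Rightarrow> 0 | Suc j \<Rightarrow> poisson_weight j s)"

lemma poisson_weight_has_derivative:
  "(poisson_weight k has_real_derivative poisson_weight_pred k s - poisson_weight k s) (at s)"
proof (cases k)
  case 0
  then show ?thesis
    unfolding poisson_weight_def poisson_weight_pred_def
    by (auto intro!: derivative_eq_intros)
next
  case (Suc j)
  have "((\<lambda>s. s ^ Suc j / fact (Suc j)) has_real_derivative real (Suc j) * s ^ j / fact (Suc j)) (at s)"
    using DERIV_cdivide[OF DERIV_pow[of "Suc j" s UNIV], of "fact (Suc j)"] by simp
  also have "real (Suc j) * s ^ j / fact (Suc j) = s ^ j / fact j"
    unfolding fact_Suc of_nat_mult by (simp del: of_nat_Suc)
  finally have d: "((\<lambda>s. s ^ Suc j / fact (Suc j)) has_real_derivative s ^ j / fact j) (at s)" .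
  have "((\<lambda>s. exp (- s) * (s ^ Suc j / fact (Suc j))) has_real_derivative
      exp (- s) * (s ^ j / fact j) - exp (- s) * (s ^ Suc j / fact (Suc j))) (at s)"
    by (rule derivative_eq_intros d refl)+ simp
  then show ?thesis
    by (simp add: Suc poisson_weight_def[abs_def] poisson_weight_pred_def del: fact_Suc power_Suc)
qed

lemma poisson_weight_Suc: "poisson_weight (Suc k) s = poisson_weight k s * (s / real (Suc k))"
  unfolding poisson_weight_def fact_Suc of_nat_mult power_Suc by (simp only: times_divide_times_eq mult_ac)

text \<open>
  This is the square-root decay behind the factor \<open>(1 + T) powr (- n * d / 2)\<close>. For \<open>k \<le> s\<close>, the
  weights of \<open>k, k + 1, \<dots>, k + m\<close> with \<open>m \<approx> sqrt s\<close> all are at least \<open>exp (- 1)\<close> times the weight of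
  \<open>k\<close>, and together they are at most \<open>1\<close>. Above \<open>s\<close> the weights decrease.
\<close>

lemma poisson_weight_le:
  assumes s: "0 < s"
  shows "poisson_weight k s \<le> exp 1 / sqrt s"
proof -
  have low: "poisson_weight k s \<le> exp 1 / sqrt s" if k: "real k \<le> s" for k
  proof -
    define m where "m = nat \<lfloor>sqrt s\<rfloor>"
    have m: "real m \<le> sqrt s" "sqrt s < real m + 1"
      using s by (auto simp: m_def)
    have step: "poisson_weight k s * (s / (s + real m)) ^ j \<le> poisson_weight (k + j) s" if "j \<le> m" for j
      using that
    proof (induction j)
      case (Suc j)
      have "poisson_weight k s * (s / (s + real m)) ^ Suc j
          = (poisson_weight k s * (s / (s + real m)) ^ j) * (s / (s + real m))" by simp
      also have "\<dots> \<le> poisson_weight (k + j) s * (s / real (Suc (k + j)))"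
        using Suc k s by (intro mult_mono divide_left_mono) (auto intro: poisson_weight_nonneg)
      also have "\<dots> = poisson_weight (k + Suc j) s" by (simp add: poisson_weight_Suc)
      finally show ?case .
    qed simp
    have ratio: "exp (- 1) \<le> (s / (s + real m)) ^ j" if "j \<le> m" for j
    proof -
      have "((s + real m) / s) ^ j \<le> exp (real m / s) ^ j"
        using s exp_ge_add_one_self[of "real m / s"] by (intro power_mono) (auto simp: field_simps)
      also have "\<dots> = exp (real j * (real m / s))" by (simp only: exp_of_nat_mult)
      also have "\<dots> \<le> exp 1"
      proof -
        have "real j * real m \<le> sqrt s * sqrt s"
          using m that s by (intro mult_mono) auto
        then show ?thesis using s by (simp add: field_simps)
      qed
      finally have "inverse (exp 1) \<le> inverse (((s + real m) / s) ^ j)"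
        using s by (intro le_imp_inverse_le) (auto intro!: zero_less_power divide_pos_pos add_pos_nonneg)
      then show ?thesis by (simp add: exp_minus flip: power_inverse)
    qed
    have "poisson_weight k s * exp (- 1) * real (m + 1) = (\<Sum>j\<le>m. poisson_weight k s * exp (- 1))"
      by simp
    also have "\<dots> \<le> (\<Sum>j\<le>m. poisson_weight (k + j) s)"
      using s by (intro sum_mono order.trans[OF mult_left_mono[OF ratio] step])
        (auto intro: poisson_weight_nonneg)
    also have "\<dots> = (\<Sum>i\<in>(+) k ` {..m}. poisson_weight i s)"
      by (subst sum.reindex) auto
    also have "\<dots> \<le> (\<Sum>i. poisson_weight i s)"
      using s poisson_weight_sums[of s]
      by (intro sum_le_suminf) (auto intro: poisson_weight_nonneg simp: sums_iff)
    also have "\<dots> = 1" using poisson_weight_sums[of s] by (simp add: sums_iff)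
    finally have "poisson_weight k s * exp (- 1) * real (m + 1) \<le> 1" .
    moreover have "poisson_weight k s * exp (- 1) * sqrt s \<le> poisson_weight k s * exp (- 1) * real (m + 1)"
      using m s by (intro mult_left_mono) (auto intro!: mult_nonneg_nonneg poisson_weight_nonneg)
    ultimately have "poisson_weight k s * exp (- 1) * sqrt s \<le> 1" by linarith
    then show ?thesis using s by (simp add: exp_minus field_simps)
  qed
  show ?thesis
  proof (cases "real k \<le> s")
    case False
    define k0 where "k0 = nat \<lfloor>s\<rfloor>"
    have k0: "real k0 \<le> s" "s < real k0 + 1" using s by (auto simp: k0_def)
    have "poisson_weight (k0 + j) s \<le> poisson_weight k0 s" for j
    proof (induction j)
      case (Suc j)
      have "poisson_weight (k0 + Suc j) s = poisson_weight (k0 + j) s * (s / real (Suc (k0 + j)))"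
        by (simp add: poisson_weight_Suc)
      also have "\<dots> \<le> poisson_weight (k0 + j) s * 1"
        using k0 s by (intro mult_left_mono) (auto intro: poisson_weight_nonneg)
      finally show ?case using Suc by simp
    qed simp
    from this[of "k - k0"] have "poisson_weight k s \<le> poisson_weight k0 s"
      using k0 False by (simp split: nat_diff_split_asm)
    then show ?thesis using low[OF k0(1)] by linarith
  qed (rule low)
qed

section \<open>Averaging over a Poisson number of equal steps\<close>

text \<open>
  If \<open>\<phi>\<close> is the mass function of a random site \<open>X\<close> and \<open>N\<close> is an independent Poisson variable of
  mean \<open>s\<close>, then this is the mass function of \<open>X + N y\<close>. Negative \<open>s\<close> is admitted so that time
  derivatives at \<open>0\<close> are two-sided.
\<close>

definition smear :: "real \<Rightarrow> int ^ 'd \<Rightarrow> (int ^ 'd \<Rightarrow> real) \<Rightarrow> int ^ 'd \<Rightarrow> real" where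
  "smear s y \<phi> x = (\<Sum>k. poisson_weight k s * \<phi> (x - int k *s y))"

lemma
  assumes "\<And>x. \<bar>\<phi> x\<bar> \<le> M"
  shows smear_summable_bounded: "summable (\<lambda>k. poisson_weight k s * \<phi> (x - int k *s y))"
    and abs_smear_le: "\<bar>smear s y \<phi> x\<bar> \<le> exp (2 * \<bar>s\<bar>) * M"
proof -
  let ?t = "\<lambda>k. poisson_weight k s * \<phi> (x - int k *s y)"
  let ?e = "\<lambda>k. exp \<bar>s\<bar> * (\<bar>s\<bar> ^ k / fact k) * M"
  have e: "?e sums (exp (2 * \<bar>s\<bar>) * M)"
    by (intro sums_mult2 exp_series_sums)
  have le: "norm (?t k) \<le> ?e k" for k
    unfolding real_norm_def abs_mult by (intro mult_mono abs_poisson_weight_le assms) auto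
  show sm: "summable ?t"
    by (rule summable_comparison_test'[of ?e]) (use e le in \<open>auto simp: sums_iff\<close>)
  have "norm (suminf ?t) \<le> suminf ?e"
    by (rule norm_suminf_le) (use e le in \<open>auto simp: sums_iff\<close>)
  then show "\<bar>smear s y \<phi> x\<bar> \<le> exp (2 * \<bar>s\<bar>) * M"
    using e by (simp add: sums_iff smear_def)
qed

lemma smear_summable:
  assumes "bounded (range \<phi>)"
  shows "summable (\<lambda>k. poisson_weight k s * \<phi> (x - int k *s y))"
proof -
  obtain M where "\<And>x. \<bar>\<phi> x\<bar> \<le> M"
    using assms by (auto simp: bounded_iff)
  then show ?thesis by (rule smear_summable_bounded)
qed

lemma smear_mono:
  assumes "0 \<le> s" "bounded (range \<phi>)" "bounded (range \<psi>)" "\<And>x. \<phi> x \<le> \<psi> x"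
  shows "smear s y \<phi> x \<le> smear s y \<psi> x"
  unfolding smear_def using assms
  by (intro suminf_le smear_summable mult_left_mono) (auto intro: poisson_weight_nonneg)

lemma smear_const: "smear s y (\<lambda>_. c) x = c"
  using sums_mult2[OF poisson_weight_sums, of s c] by (simp add: smear_def sums_iff)

lemma smear_add:
  assumes "bounded (range \<phi>)" "bounded (range \<psi>)"
  shows "smear s y (\<lambda>x. \<phi> x + \<psi> x) x = smear s y \<phi> x + smear s y \<psi> x"
  unfolding smear_def using assms
  by (subst suminf_add) (auto intro: smear_summable simp: algebra_simps)

lemma smear_cmult:
  assumes "bounded (range \<phi>)"
  shows "smear s y (\<lambda>x. c * \<phi> x) x = c * smear s y \<phi> x"
  unfolding smear_def using assms
  by (subst suminf_mult[symmetric]) (auto intro: smear_summable simp: mult_ac)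

lemma smear_diff:
  assumes "bounded (range \<phi>)" "bounded (range \<psi>)"
  shows "smear s y (\<lambda>x. \<phi> x - \<psi> x) x = smear s y \<phi> x - smear s y \<psi> x"
  unfolding smear_def using assms
  by (subst suminf_diff) (auto intro: smear_summable simp: algebra_simps)

lemma smear_translate: "smear s y (\<lambda>x. \<phi> (x - z)) x = smear s y \<phi> (x - z)"
  by (simp add: smear_def algebra_simps)

lemma bounded_range_shift:
  fixes \<phi> :: "'a::ab_group_add \<Rightarrow> real"
  assumes "bounded (range \<phi>)"
  shows "bounded (range (\<lambda>x. \<phi> (x - z)))"
  by (rule bounded_subset[OF assms]) auto

lemma bounded_range_cmult:
  fixes \<phi> :: "'a \<Rightarrow> real"
  assumes "bounded (range \<phi>)"
  shows "bounded (range (\<lambda>x. c * \<phi> x))"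
  using bounded_scaling[OF assms, of c] by (simp add: image_image)

lemma bounded_range_sum_list:
  fixes \<phi> :: "int ^ 'd \<Rightarrow> real"
  assumes "bounded (range \<phi>)"
  shows "bounded (range (\<lambda>x. \<Sum>z\<leftarrow>l. a z * (\<phi> (x - z) - \<phi> x)))"
proof -
  have "bounded (range (\<lambda>x. \<phi> (x - z)))" for z
    by (rule bounded_range_shift[OF assms])
  then show ?thesis
    using assms
    by (induction l) (auto intro!: bounded_plus_comp bounded_range_cmult bounded_minus_comp)
qed

lemma smear_sum_list:
  assumes "bounded (range \<phi>)"
  shows "smear s y (\<lambda>x. \<Sum>z\<leftarrow>l. a z * (\<phi> (x - z) - \<phi> x)) x
    = (\<Sum>z\<leftarrow>l. a z * (smear s y \<phi> (x - z) - smear s y \<phi> x))"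
proof (induction l)
  case (Cons z l)
  have b: "bounded (range (\<lambda>x. \<phi> (x - z) - \<phi> x))"
    by (intro bounded_minus_comp bounded_range_shift assms)
  show ?case
    using Cons smear_add[OF bounded_range_cmult[OF b] bounded_range_sum_list[OF assms]]
    by (simp add: smear_cmult[OF b] smear_diff bounded_range_shift assms smear_translate)
qed (simp add: smear_const)

lemma smear_pred:
  assumes "bounded (range \<phi>)"
  shows "(\<lambda>k. poisson_weight_pred k s * \<phi> (x - int k *s y)) sums smear s y \<phi> (x - y)"
proof -
  have "(\<lambda>k. poisson_weight_pred (Suc k) s * \<phi> (x - int (Suc k) *s y)) sums smear s y \<phi> (x - y)"
    using smear_summable[OF assms, of s "x - y" y]
    by (simp add: smear_def poisson_weight_pred_def sums_iff vector_sadd_rdistrib algebra_simps)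
  from sums_Suc[OF this] show ?thesis by (simp add: poisson_weight_pred_def)
qed

text \<open>
  The product rule for \<open>exp (a * s * (shift - 1)) \<phi> s\<close>. The series is differentiated term by term;
  the derivatives converge uniformly on \<open>{- R..R}\<close> because the Poisson weights are dominated there
  by the terms of an exponential series.
\<close>

lemma smear_has_derivative:
  fixes \<phi> :: "real \<Rightarrow> int ^ 'd \<Rightarrow> real"
  assumes d: "\<And>t x. ((\<lambda>s. \<phi> s x) has_real_derivative \<phi>' t x) (at t)"
    and bdd: "\<And>t x. \<bar>t\<bar> \<le> R \<Longrightarrow> \<bar>\<phi> t x\<bar> \<le> M" "\<And>t x. \<bar>t\<bar> \<le> R \<Longrightarrow> \<bar>\<phi>' t x\<bar> \<le> M"
    and t: "\<bar>t\<bar> < R"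
  shows "((\<lambda>s. smear (a * s) y (\<phi> s) x) has_real_derivative
      a * (smear (a * t) y (\<phi> t) (x - y) - smear (a * t) y (\<phi> t) x) + smear (a * t) y (\<phi>' t) x) (at t)"
proof -
  define A where "A = \<bar>a\<bar> * R"
  define E where "E k = exp A * (A ^ k / fact k)" for k :: nat
  define E' where "E' k = (case k of 0 \<Rightarrow> 0 | Suc j \<Rightarrow> E j)" for k :: nat
  define f where "f k s = poisson_weight k (a * s) * \<phi> s (x - int k *s y)" for k s
  define f' where "f' k s = a * (poisson_weight_pred k (a * s) * \<phi> s (x - int k *s y)
      - poisson_weight k (a * s) * \<phi> s (x - int k *s y))
      + poisson_weight k (a * s) * \<phi>' s (x - int k *s y)" for k s
  have R: "0 < R" using t by auto
  have M: "0 \<le> M" using order.trans[OF abs_ge_zero bdd(1)[of 0 0]] R by simp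
  have summ: "summable E"
    using exp_series_sums[of A] by (simp add: E_def[abs_def] sums_iff)
  then have summ': "summable E'"
    using summable_Suc_iff[of E'] by (simp add: E'_def)
  have A: "\<bar>a * s\<bar> \<le> A" if "\<bar>s\<bar> \<le> R" for s
    using that by (auto simp: A_def abs_mult intro: mult_left_mono)
  have pw: "\<bar>poisson_weight k (a * s)\<bar> \<le> E k" "\<bar>poisson_weight_pred k (a * s)\<bar> \<le> E' k"
    if "\<bar>s\<bar> \<le> R" for k s
    using abs_poisson_weight_le[OF A[OF that]]
    by (auto simp: E_def E'_def poisson_weight_pred_def split: nat.splits)
  have df: "(f k has_real_derivative f' k s) (at s)" for k s
  proof -
    have "((\<lambda>s. poisson_weight k (a * s)) has_real_derivative
        (poisson_weight_pred k (a * s) - poisson_weight k (a * s)) * a) (at s)"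
      by (rule DERIV_chain2[OF poisson_weight_has_derivative]) (auto intro!: derivative_eq_intros)
    from DERIV_mult[OF this d[where t = s and x = "x - int k *s y"]] show ?thesis
      unfolding f_def f'_def by (simp add: algebra_simps)
  qed
  have uc: "uniformly_convergent_on {-R..R} (\<lambda>n s. \<Sum>i<n. f' i s)"
  proof (rule uniformly_convergentI, rule Weierstrass_m_test)
    show "summable (\<lambda>k. \<bar>a\<bar> * (E' k * M + E k * M) + E k * M)"
      using summ summ' by (intro summable_add summable_mult summable_mult2)
    fix k s assume "s \<in> {-R..R}"
    then have s: "\<bar>s\<bar> \<le> R" by auto
    have "\<bar>f' k s\<bar> \<le> \<bar>a\<bar> * (\<bar>poisson_weight_pred k (a * s)\<bar> * \<bar>\<phi> s (x - int k *s y)\<bar>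
      + \<bar>poisson_weight k (a * s)\<bar> * \<bar>\<phi> s (x - int k *s y)\<bar>)
      + \<bar>poisson_weight k (a * s)\<bar> * \<bar>\<phi>' s (x - int k *s y)\<bar>"
      unfolding f'_def
      by (intro order.trans[OF abs_triangle_ineq] add_mono)
        (simp_all only: abs_mult mult_left_mono abs_ge_zero order.trans[OF abs_triangle_ineq4] order_refl)
    also have "\<dots> \<le> \<bar>a\<bar> * (E' k * M + E k * M) + E k * M"
      using pw[OF s, of k] bdd[OF s] M
      by (intro add_mono mult_left_mono mult_mono) (auto intro: order.trans[OF abs_ge_zero])
    finally show "norm (f' k s) \<le> \<bar>a\<bar> * (E' k * M + E k * M) + E k * M" by simp
  qed
  have b: "bounded (range (\<phi> t))" "bounded (range (\<phi>' t))"
    using bdd t by (auto simp: bounded_iff intro!: exI[of _ M])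
  have "((\<lambda>s. \<Sum>k. f k s) has_real_derivative (\<Sum>k. f' k t)) (at t)"
  proof (rule has_field_derivative_series'(2)[OF _ _ uc])
    show "summable (\<lambda>k. f k t)" unfolding f_def by (rule smear_summable[OF b(1)])
  qed (use t df in \<open>auto intro: has_field_derivative_at_within\<close>)
  moreover have "(\<Sum>k. f' k t) =
      a * (smear (a * t) y (\<phi> t) (x - y) - smear (a * t) y (\<phi> t) x) + smear (a * t) y (\<phi>' t) x"
  proof -
    have "(\<lambda>k. poisson_weight k (a * t) * \<phi> t (x - int k *s y)) sums smear (a * t) y (\<phi> t) x"
      "(\<lambda>k. poisson_weight k (a * t) * \<phi>' t (x - int k *s y)) sums smear (a * t) y (\<phi>' t) x"
      unfolding smear_def by (intro summable_sums smear_summable b)+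
    from sums_add[OF sums_mult[OF sums_diff[OF smear_pred[OF b(1)] this(1)], of a] this(2)]
    show ?thesis unfolding f'_def by (simp add: sums_iff)
  qed
  ultimately show ?thesis by (simp add: f_def smear_def)
qed

section \<open>The heat kernel of a random walk\<close>

text \<open>
  The mass function at time \<open>t\<close> of the continuous-time walk from \<open>0\<close> that makes the step \<open>y\<close> at rate
  \<open>a y\<close>, for \<open>y\<close> in the list: the numbers of steps of each kind are independent Poisson variables.
  Building the kernel one kind of step at a time makes both the exponential change of measure and
  the uniform bound below provable by induction over the list.
\<close>

primrec step_kernel :: "(int ^ 'd \<Rightarrow> real) \<Rightarrow> (int ^ 'd) list \<Rightarrow> real \<Rightarrow> int ^ 'd \<Rightarrow> real" where
  "step_kernel a [] t = (\<lambda>x. if x = 0 then 1 else 0)"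
| "step_kernel a (y # l) t = smear (a y * t) y (step_kernel a l t)"

lemma abs_kernel_le: "\<bar>step_kernel a l t x\<bar> \<le> exp (2 * (\<Sum>y\<leftarrow>l. \<bar>a y\<bar>) * \<bar>t\<bar>)"
proof (induction l arbitrary: x)
  case (Cons y l)
  then show ?case
    using abs_smear_le[of "step_kernel a l t", OF Cons.IH, of "a y * t" y x]
    by (simp add: abs_mult algebra_simps flip: exp_add)
qed simp

lemma bounded_kernel: "bounded (range (step_kernel a l t))"
  by (rule boundedI[of _ "exp (2 * (\<Sum>y\<leftarrow>l. \<bar>a y\<bar>) * \<bar>t\<bar>)"]) (auto intro: abs_kernel_le)

text \<open>
  The forward equation, from the product rule for one kind of step at a time.
\<close>

lemma kernel_has_derivative:
  "((\<lambda>s. step_kernel a l s x) has_real_derivative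
     (\<Sum>z\<leftarrow>l. a z * (step_kernel a l t (x - z) - step_kernel a l t x))) (at t)"
proof (induction l arbitrary: t x)
  case (Cons y l)
  define s where "s = (\<Sum>y\<leftarrow>l. \<bar>a y\<bar>)"
  define R where "R = \<bar>t\<bar> + 1"
  define M where "M = exp (2 * s * R)"
  have s: "0 \<le> s" unfolding s_def by (intro sum_list_nonneg) auto
  have M: "0 \<le> M" by (simp add: M_def)
  have b: "\<bar>step_kernel a l t x\<bar> \<le> M" if "\<bar>t\<bar> \<le> R" for t x
  proof -
    have "2 * s * \<bar>t\<bar> \<le> 2 * s * R" using that s by (intro mult_left_mono) auto
    then show ?thesis using abs_kernel_le[of a l t x] unfolding s_def[symmetric] M_def
      by (meson exp_le_cancel_iff order.trans)
  qed
  have b': "\<bar>\<Sum>z\<leftarrow>l'. a z * (step_kernel a l t (x - z) - step_kernel a l t x)\<bar> \<le> 2 * (\<Sum>y\<leftarrow>l'. \<bar>a y\<bar>) * M"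
    if t: "\<bar>t\<bar> \<le> R" for t x l'
  proof (induction l')
    case (Cons z l')
    have "\<bar>a z * (step_kernel a l t (x - z) - step_kernel a l t x)\<bar> \<le> \<bar>a z\<bar> * (2 * M)"
      unfolding abs_mult using b[OF t, of x] b[OF t, of "x - z"]
      by (intro mult_left_mono) auto
    then show ?case using Cons by (simp add: algebra_simps)
  qed simp
  have "((\<lambda>s. smear (a y * s) y (step_kernel a l s) x) has_real_derivative
      a y * (smear (a y * t) y (step_kernel a l t) (x - y) - smear (a y * t) y (step_kernel a l t) x)
      + smear (a y * t) y (\<lambda>x. \<Sum>z\<leftarrow>l. a z * (step_kernel a l t (x - z) - step_kernel a l t x)) x) (at t)"
  proof (rule smear_has_derivative[where R = R and M = "(1 + 2 * s) * M"])
    show "\<bar>step_kernel a l t x\<bar> \<le> (1 + 2 * s) * M" if "\<bar>t\<bar> \<le> R" for t x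
      using b[OF that, of x] mult_nonneg_nonneg[OF s M] by (simp add: algebra_simps)
    show "\<bar>\<Sum>z\<leftarrow>l. a z * (step_kernel a l t (x - z) - step_kernel a l t x)\<bar> \<le> (1 + 2 * s) * M"
      if "\<bar>t\<bar> \<le> R" for t x
      using b'[OF that, where l' = l and x = x] M by (simp add: algebra_simps s_def)
  qed (use Cons.IH in \<open>auto simp: R_def\<close>)
  then show ?case
    by (simp add: smear_sum_list bounded_kernel)
qed simp

lemma kernel_nonneg:
  assumes "0 \<le> t" "\<And>y. y \<in> set l \<Longrightarrow> 0 \<le> a y"
  shows "0 \<le> step_kernel a l t x"
  using assms(2)
proof (induction l arbitrary: x)
  case (Cons y l)
  have "smear (a y * t) y (\<lambda>_. 0) x \<le> smear (a y * t) y (step_kernel a l t) x"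
    using assms(1) Cons by (intro smear_mono bounded_kernel) auto
  then show ?case by (simp add: smear_const)
qed simp

text \<open>
  Further independent steps only average the kernel, so they do not increase its supremum.
\<close>

lemma kernel_append_le:
  assumes "0 \<le> t" "\<And>y. y \<in> set r \<Longrightarrow> 0 \<le> a y" "\<And>x. step_kernel a l t x \<le> c"
  shows "step_kernel a (r @ l) t x \<le> c"
  using assms(2)
proof (induction r arbitrary: x)
  case (Cons y r)
  have "smear (a y * t) y (step_kernel a (r @ l) t) x \<le> smear (a y * t) y (\<lambda>_. c) x"
    using assms(1) Cons by (intro smear_mono bounded_kernel) auto
  then show ?case by (simp add: smear_const)
qed (use assms in simp)

lemma smear_0 [simp]: "smear 0 y \<phi> = \<phi>"
proof
  fix x
  have "(\<lambda>k. poisson_weight k 0 * \<phi> (x - int k *s y)) sums (\<Sum>k\<in>{0}. poisson_weight k 0 * \<phi> (x - int k *s y))"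
    by (rule sums_finite) (auto simp: poisson_weight_def)
  then show "smear 0 y \<phi> x = \<phi> x"
    by (simp add: smear_def sums_iff poisson_weight_def)
qed

lemma kernel_0: "step_kernel a l 0 x = (if x = 0 then 1 else 0)"
  by (induction l arbitrary: x) auto

text \<open>
  Independent steps commute: both kernels solve the same forward equation with the same
  initial value, and the comparison principle gives uniqueness of bounded solutions. This allows
  the steps of a basis to be moved to the inner end of the list, in a way that depends on the tilt.
\<close>

lemma kernel_cong_set:
  assumes a: "\<And>y. y \<in> set l \<Longrightarrow> 0 \<le> a y" and l: "distinct l" "distinct l'" "set l = set l'"
    and t: "0 \<le> t"
  shows "step_kernel a l t x = step_kernel a l' t x"
proof -
  have le: "step_kernel a l t x \<le> step_kernel a l' t x"
    if a: "\<And>y. y \<in> set l \<Longrightarrow> 0 \<le> a y" and l: "distinct l" "distinct l'" "set l = set l'"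
    for l l'
  proof -
    define k where "k t x = step_kernel a l' t x - step_kernel a l t x" for t x
    define k' where "k' t x = (\<Sum>z\<in>set l. a z * (k t (x - z) - k t x))" for t x
    define M where "M = exp (2 * (\<Sum>y\<leftarrow>l. \<bar>a y\<bar>) * \<bar>t\<bar>)"
    have "0 \<le> k t x"
    proof (rule comparison_principle[where k = k and S = UNIV and c = "\<Sum>z\<in>set l. a z" and k' = k' and M = M and T = t])
      show "((\<lambda>s. k s x) has_real_derivative k' t x) (at t within {0..})" for t x
      proof -
        have "((\<lambda>s. k s x) has_real_derivative
            (\<Sum>z\<leftarrow>l'. a z * (step_kernel a l' t (x - z) - step_kernel a l' t x))
            - (\<Sum>z\<leftarrow>l. a z * (step_kernel a l t (x - z) - step_kernel a l t x))) (at t)"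
          unfolding k_def by (intro DERIV_diff kernel_has_derivative)
        also have "(\<Sum>z\<leftarrow>l'. a z * (step_kernel a l' t (x - z) - step_kernel a l' t x))
            - (\<Sum>z\<leftarrow>l. a z * (step_kernel a l t (x - z) - step_kernel a l t x)) = k' t x"
          unfolding k'_def k_def sum_list_distinct_conv_sum_set[OF l(1)]
            sum_list_distinct_conv_sum_set[OF l(2)] l(3) sum_subtractf[symmetric]
          by (intro sum.cong refl) (simp add: algebra_simps)
        finally show ?thesis by (rule has_field_derivative_at_within)
      qed
      show "- M \<le> k s x" if "0 \<le> s" "s \<le> t" for s x
      proof -
        have "2 * (\<Sum>y\<leftarrow>l. \<bar>a y\<bar>) * \<bar>s\<bar> \<le> 2 * (\<Sum>y\<leftarrow>l. \<bar>a y\<bar>) * \<bar>t\<bar>"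
          using that by (intro mult_left_mono) (auto intro!: sum_list_nonneg)
        then have "exp (2 * (\<Sum>y\<leftarrow>l. \<bar>a y\<bar>) * \<bar>s\<bar>) \<le> M"
          unfolding M_def by simp
        moreover have "0 \<le> step_kernel a l' s x"
          using that a l by (intro kernel_nonneg) auto
        ultimately show ?thesis
          using abs_kernel_le[of a l s x] by (simp add: k_def)
      qed
      show "- (\<Sum>z\<in>set l. a z) * (B + k t x) \<le> k' t x"
        if "\<And>b. b \<in> UNIV \<Longrightarrow> - B \<le> k t b" for t x B
      proof -
        have "- (\<Sum>z\<in>set l. a z) * (B + k t x) = (\<Sum>z\<in>set l. a z) * (- B - k t x)"
          by (simp add: algebra_simps)
        also have "\<dots> = (\<Sum>z\<in>set l. a z * (- B - k t x))"
          by (rule sum_distrib_right)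
        also have "\<dots> \<le> k' t x"
          unfolding k'_def using a that by (intro sum_mono mult_left_mono) auto
        finally show ?thesis .
      qed
      show "0 \<le> (\<Sum>z\<in>set l. a z)" using a by (rule sum_nonneg)
      show "0 \<le> k 0 x" for x by (simp add: k_def kernel_0)
    qed (use t in simp_all)
    then show ?thesis by (simp add: k_def)
  qed
  show ?thesis
    by (intro antisym le) (use a l in simp_all)
qed

lemma additive_int_scale:
  fixes e :: "int ^ 'd \<Rightarrow> real"
  assumes "\<And>x y. e (x + y) = e x + e y"
  shows "e (x - int k *s y) = e x - real k * e y"
proof -
  have 0: "e 0 = 0" using assms[of 0 0] by simp
  have "e (int k *s y) = real k * e y"
    by (induction k) (simp_all add: 0 vector_sadd_rdistrib assms algebra_simps)
  then show ?thesis
    using assms[of "x - int k *s y" "int k *s y"] by simp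
qed

text \<open>
  A Poisson law of mean \<open>s\<close>, weighted by \<open>exp (k * e y)\<close>, is up to normalization the Poisson law of mean
  \<open>s * exp (e y)\<close>.
\<close>

lemma smear_tilt:
  fixes e :: "int ^ 'd \<Rightarrow> real"
  assumes e: "\<And>x y. e (x + y) = e x + e y" and b: "bounded (range \<phi>)"
  shows "exp (e x) * smear s y \<phi> x
    = exp (s * (exp (e y) - 1)) * smear (s * exp (e y)) y (\<lambda>x. exp (e x) * \<phi> x) x"
proof -
  have eq: "exp (- (s * (exp (e y) - 1))) * (exp (e x) * (poisson_weight k s * \<phi> (x - int k *s y)))
    = poisson_weight k (s * exp (e y)) * (exp (e (x - int k *s y)) * \<phi> (x - int k *s y))" for k
  proof -
    have eq1: "exp (- (s * (exp (e y) - 1))) * exp (- s) = exp (- (s * exp (e y)))"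
      by (simp add: algebra_simps flip: exp_add)
    have eq2: "exp (e (x - int k *s y)) * exp (e y) ^ k = exp (e x)"
      by (simp add: additive_int_scale[of e, OF e] flip: exp_of_nat_mult exp_add)
    have "exp (- (s * (exp (e y) - 1))) * (exp (e x) * (poisson_weight k s * \<phi> (x - int k *s y)))
        = (exp (- (s * (exp (e y) - 1))) * exp (- s)) * exp (e x) * (s ^ k / fact k * \<phi> (x - int k *s y))"
      by (simp add: poisson_weight_def)
    also have "\<dots> = exp (- (s * exp (e y))) * (exp (e (x - int k *s y)) * exp (e y) ^ k)
        * (s ^ k / fact k * \<phi> (x - int k *s y))"
      by (simp only: eq1 eq2)
    also have "\<dots> = poisson_weight k (s * exp (e y)) * (exp (e (x - int k *s y)) * \<phi> (x - int k *s y))"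
      by (simp add: poisson_weight_def power_mult_distrib)
    finally show ?thesis .
  qed
  have "smear (s * exp (e y)) y (\<lambda>x. exp (e x) * \<phi> x) x
      = exp (- (s * (exp (e y) - 1))) * (exp (e x) * smear s y \<phi> x)"
    unfolding smear_def eq[symmetric]
    using smear_summable[OF b, of s x y] by (subst suminf_mult; simp add: suminf_mult)
  then show ?thesis by (simp add: exp_minus)
qed

text \<open>
  Exponential change of measure. The tilted walk is again a walk of independent Poisson steps, with
  rates \<open>a y * exp (e y)\<close>.
\<close>

lemma kernel_tilt:
  fixes e :: "int ^ 'd \<Rightarrow> real"
  assumes e: "\<And>x y. e (x + y) = e x + e y"
  shows "exp (e x) * step_kernel a l t x
    = exp (t * (\<Sum>y\<leftarrow>l. a y * (exp (e y) - 1))) * step_kernel (\<lambda>y. a y * exp (e y)) l t x"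
proof (induction l arbitrary: x)
  case Nil
  have "e 0 = 0" using e[of 0 0] by simp
  then show ?case by simp
next
  case (Cons y l)
  show ?case
    by (simp add: smear_tilt[of e, OF e bounded_kernel] Cons.IH smear_cmult[OF bounded_kernel])
      (simp add: algebra_simps exp_add exp_diff)
qed

section \<open>A uniform bound from linearly independent steps\<close>

definition real_vec :: "int ^ 'd \<Rightarrow> real ^ 'd" where
  "real_vec x = (\<chi> j. real_of_int (x $ j))"

lemma real_vec_simps [simp]:
  "real_vec (x + y) = real_vec x + real_vec y"
  "real_vec (x - y) = real_vec x - real_vec y"
  "real_vec (- x) = - real_vec x"
  "real_vec 0 = 0"
  "real_vec (int k *s x) = real k *\<^sub>R real_vec x"
  by (simp_all add: real_vec_def vec_eq_iff)

lemma inj_real_vec: "inj real_vec"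
  by (rule injI) (simp add: real_vec_def vec_eq_iff)

text \<open>
  Linear independence in the triangular form that an induction over the list can use.
\<close>

primrec independent_steps :: "(int ^ 'd) list \<Rightarrow> bool" where
  "independent_steps [] = True"
| "independent_steps (y # l) \<longleftrightarrow> real_vec y \<notin> span (real_vec ` set l) \<and> independent_steps l"

lemma kernel_support:
  "step_kernel a l t x \<noteq> 0 \<Longrightarrow> real_vec x \<in> span (real_vec ` set l)"
proof (induction l arbitrary: x)
  case (Cons y l)
  have "\<exists>k. step_kernel a l t (x - int k *s y) \<noteq> 0"
  proof (rule ccontr)
    assume "\<not> ?thesis"
    then have "step_kernel a (y # l) t x = 0" by (simp add: smear_def)
    with Cons.prems show False by simp
  qed
  then obtain k where "step_kernel a l t (x - int k *s y) \<noteq> 0" by blast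
  then have "real_vec (x - int k *s y) \<in> span (real_vec ` set (y # l))"
    by (intro subsetD[OF span_mono Cons.IH]) auto
  moreover have "real k *\<^sub>R real_vec y \<in> span (real_vec ` set (y # l))"
    by (intro span_scale span_base) auto
  ultimately have "real_vec (x - int k *s y) + real k *\<^sub>R real_vec y \<in> span (real_vec ` set (y # l))"
    by (rule span_add)
  then show ?case by simp
qed (auto split: if_splits)

text \<open>
  For linearly independent steps, a site determines the number of steps of each kind. Hence a
  single term of each Poisson series survives, and the kernel is a product of Poisson weights.
\<close>

lemma kernel_le_independent:
  assumes "independent_steps l" "0 \<le> t"
    and "\<And>y. y \<in> set l \<Longrightarrow> 0 \<le> a y" "\<And>y k. y \<in> set l \<Longrightarrow> poisson_weight k (a y * t) \<le> c y"
  shows "step_kernel a l t x \<le> (\<Prod>y\<leftarrow>l. c y)"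
  using assms
proof (induction l arbitrary: x)
  case (Cons y l)
  have c: "0 \<le> c z" if "z \<in> set (y # l)" for z
    using poisson_weight_nonneg[of "a z * t" 0] Cons.prems(2) Cons.prems(3)[OF that]
      Cons.prems(4)[OF that, of 0] by (meson mult_nonneg_nonneg order.trans)
  have prod: "0 \<le> (\<Prod>z\<leftarrow>l. c z)"
    using c by (induction l) (auto intro!: mult_nonneg_nonneg)
  show ?case
  proof (cases "\<exists>k. step_kernel a l t (x - int k *s y) \<noteq> 0")
    case False
    then show ?thesis using prod c[of y] by (simp add: smear_def)
  next
    case True
    then obtain k where k: "step_kernel a l t (x - int k *s y) \<noteq> 0" by blast
    have uniq: "step_kernel a l t (x - int j *s y) = 0" if "j \<noteq> k" for j
    proof (rule ccontr)
      assume "step_kernel a l t (x - int j *s y) \<noteq> 0"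
      with k have "real_vec (x - int k *s y) - real_vec (x - int j *s y) \<in> span (real_vec ` set l)"
        by (intro span_diff kernel_support)
      then have "(real j - real k) *\<^sub>R real_vec y \<in> span (real_vec ` set l)"
        by (simp add: algebra_simps)
      from span_scale[OF this, of "1 / (real j - real k)"] that
      have "real_vec y \<in> span (real_vec ` set l)" by simp
      then show False using Cons.prems(1) by simp
    qed
    have "(\<lambda>j. poisson_weight j (a y * t) * step_kernel a l t (x - int j *s y)) sums
        (\<Sum>j\<in>{k}. poisson_weight j (a y * t) * step_kernel a l t (x - int j *s y))"
      by (rule sums_finite) (auto simp: uniq)
    then have "step_kernel a (y # l) t x = poisson_weight k (a y * t) * step_kernel a l t (x - int k *s y)"
      by (simp add: smear_def sums_iff)
    also have "\<dots> \<le> c y * (\<Prod>z\<leftarrow>l. c z)"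
      using Cons.prems c by (intro mult_mono Cons.IH kernel_nonneg) auto
    finally show ?thesis by simp
  qed
qed simp

text \<open>
  By irreducibility, every unit vector is a sum of steps.
\<close>

lemma span_steps:
  fixes p :: "(int ^ 'd) pmf"
  assumes "irreducible_walk p"
  shows "span (real_vec ` set_pmf p) = UNIV"
proof -
  have walk: "real_vec y \<in> span (real_vec ` set_pmf p)" if "y \<in> set_pmf (walk p 0 k)" for k y
    using that
  proof (induction k arbitrary: y)
    case (Suc k)
    then show ?case by (auto intro!: span_add[OF _ span_base])
  qed (auto simp: span_zero)
  have "real_vec y \<in> span (real_vec ` set_pmf p)" for y
    using walk[of y] assms unfolding irreducible_walk_def by (metis less_irrefl set_pmf_iff)
  then have "real_vec (axis i 1) \<in> span (real_vec ` set_pmf p)" for i by blast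
  moreover have "real_vec (axis i 1) = axis i 1" for i :: 'd
    by (simp add: real_vec_def axis_def vec_eq_iff)
  ultimately have "Basis \<subseteq> span (real_vec ` set_pmf p)"
    by (auto simp: Basis_vec_def)
  from span_minimal[OF this] show ?thesis by auto
qed

lemma independent_steps_if_independent:
  assumes "independent (real_vec ` set l)" "distinct l"
  shows "independent_steps l"
  using assms
proof (induction l)
  case (Cons y l)
  have "real_vec y \<notin> real_vec ` set l"
    using Cons.prems(2) by (auto simp: inj_eq[OF inj_real_vec])
  then show ?case using Cons by (simp add: independent_insert)
qed simp

lemma exists_independent_steps:
  fixes p :: "(int ^ 'd) pmf"
  assumes "irreducible_walk p"
  obtains l where "set l \<subseteq> set_pmf p" "independent_steps l" "length l = CARD('d)"
proof -
  obtain B where B: "B \<subseteq> real_vec ` set_pmf p" "independent B" "real_vec ` set_pmf p \<subseteq> span B"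
    by (rule maximal_independent_subset)
  have "span B = UNIV"
    using span_steps[OF assms] span_minimal[OF B(3)] by auto
  then have card: "card B = CARD('d)"
    using basis_card_eq_dim[of B UNIV] B(2) by simp
  obtain L where L: "L \<subseteq> set_pmf p" "B = real_vec ` L"
    using B(1) by (auto simp: subset_image_iff)
  have inj: "inj_on real_vec L" using inj_real_vec by (rule inj_on_subset) simp
  have "finite B" using B(2) by (rule finiteI_independent)
  then have "finite L" using L inj by (simp add: finite_image_iff)
  then obtain l where l: "set l = L" "distinct l" using finite_distinct_list by blast
  have "length l = CARD('d)"
    using card l L inj by (metis card_image distinct_card)
  then show ?thesis
    using that[of l] l L B(2) independent_steps_if_independent[of l] by auto
qed

text \<open>
  A tilt makes one of the two rates of \<open>y\<close> and \<open>- y\<close> small. Replacing \<open>y\<close> by \<open>- y\<close> where this is needed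
  keeps the steps independent.
\<close>

lemma independent_steps_flip:
  assumes "independent_steps l" "\<And>y. s y = y \<or> s y = - y"
  shows "independent_steps (map s l)"
  using assms(1)
proof (induction l)
  case (Cons y l)
  have "real_vec ` set (map s l) \<subseteq> span (real_vec ` set l)"
    using assms(2) by (auto intro: span_base span_neg) (metis imageI real_vec_simps(3) span_base span_neg)
  then have "span (real_vec ` set (map s l)) \<subseteq> span (real_vec ` set l)"
    by (intro span_minimal) auto
  moreover have "real_vec y = real_vec (s y) \<or> real_vec y = - real_vec (s y)"
    using assms(2)[of y] by (metis minus_minus real_vec_simps(3))
  ultimately show ?case
    using Cons by (auto dest: span_neg)
qed simp

lemma independent_steps_distinct: "independent_steps l \<Longrightarrow> distinct l"
  by (induction l) (auto intro: span_base)

section \<open>Product functions under the exclusion generator\<close>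

text \<open>
  The generator as a finite sum over jumps of one particle to an empty site. A bond contributes
  only if exactly one of its end points is occupied, and then it corresponds to exactly one such jump.
\<close>

lemma generator_eq:
  fixes p :: "'a::ab_group_add pmf"
  assumes sym: "symmetric_law p" and fin: "finite (set_pmf p)" and A: "finite A"
  shows "generator p h A = (\<Sum>x\<in>A. \<Sum>y\<in>set_pmf p.
    if x + y \<in> A then 0 else pmf p y * (h (insert (x + y) (A - {x})) - h A))"
proof -
  define I where "I = (SIGMA x:A. {y \<in> set_pmf p. x + y \<notin> A})"
  define g where "g = (\<lambda>(x, y). {x, x + y :: 'a})"
  have neg: "- y \<in> set_pmf p \<longleftrightarrow> y \<in> set_pmf p" for y
    using sym by (simp add: symmetric_law_def set_pmf_iff)
  have finI: "finite I" unfolding I_def using A fin by (intro finite_SigmaI) auto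
  have inj: "inj_on g I"
    by (auto simp: inj_on_def g_def I_def doubleton_eq_iff)
  have sub: "g ` I \<subseteq> bonds"
  proof
    fix b assume "b \<in> g ` I"
    then obtain x y where "x \<in> A" "x + y \<notin> A" "b = {x, x + y}" by (auto simp: I_def g_def)
    moreover from this have "x \<noteq> x + y" by metis
    ultimately show "b \<in> bonds" unfolding bonds_def by blast
  qed
  have zero: "bond_term p h A b = 0" if bond: "b \<in> bonds" and out: "b \<notin> g ` I" for b
  proof -
    obtain x y where b: "b = {x, y}" using bond unfolding bonds_def by blast
    have mem: "{x, y} \<in> g ` I" if "x \<in> A" "y \<notin> A" "y - x \<in> set_pmf p" for x y
      using that by (intro image_eqI[of _ _ "(x, y - x)"]) (auto simp: I_def g_def)
    show ?thesis
    proof (rule ccontr)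
      assume "bond_term p h A b \<noteq> 0"
      then have nz: "y - x \<in> set_pmf p" "exchange x y A \<noteq> A"
        by (auto simp: b bond_term_eq[OF sym] set_pmf_iff)
      then have "x - y \<in> set_pmf p" using neg[of "y - x"] by simp
      then have "{x, y} \<in> g ` I"
        using nz(1) mem[of x y] mem[of y x] insert_commute[of x y "{}"]
        by (cases "x \<in> A"; cases "y \<in> A") (use nz(2) in \<open>simp_all add: exchange_def\<close>)
      with out b show False by simp
    qed
  qed
  have "generator p h A = infsum (bond_term p h A) (g ` I)"
    unfolding generator_def using sub zero by (intro infsum_cong_neutral) auto
  also have "\<dots> = sum (bond_term p h A) (g ` I)"
    using finI by simp
  also have "\<dots> = (\<Sum>i\<in>I. bond_term p h A (g i))"
    by (simp add: sum.reindex[OF inj])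
  also have "\<dots> = (\<Sum>(x, y)\<in>I. pmf p y * (h (insert (x + y) (A - {x})) - h A))"
    by (intro sum.cong refl)
      (auto simp: I_def g_def bond_term_eq[OF sym] exchange_def)
  also have "\<dots> = (\<Sum>x\<in>A. \<Sum>y\<in>{y \<in> set_pmf p. x + y \<notin> A}. pmf p y * (h (insert (x + y) (A - {x})) - h A))"
    unfolding I_def using A fin by (subst sum.Sigma) auto
  also have "\<dots> = (\<Sum>x\<in>A. \<Sum>y\<in>set_pmf p.
      if x + y \<in> A then 0 else pmf p y * (h (insert (x + y) (A - {x})) - h A))"
    unfolding sum.inter_filter[OF fin] by (intro sum.cong refl) simp
  finally show ?thesis .
qed

text \<open>
  Liggett's comparison of exclusion with independent particles, in the case of product functions:
  the right-hand side is the generator of independent walks applied to the product. It exceeds the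
  exclusion generator by the jumps onto occupied sites. In these, the jump from \<open>x\<close> to \<open>z\<close> and the jump
  from \<open>z\<close> to \<open>x\<close> have the same rate by symmetry, and together they contribute \<open>(u z - u x)\<^sup>2\<close> times
  the product over the other particles.
\<close>

lemma generator_prod_le:
  fixes p :: "'a::ab_group_add pmf"
  assumes sym: "symmetric_law p" and fin: "finite (set_pmf p)" and A: "finite A"
    and u: "\<And>x. 0 \<le> u x"
  shows "generator p (\<lambda>A. \<Prod>x\<in>A. u x) A
    \<le> (\<Sum>x\<in>A. (\<Sum>y\<in>set_pmf p. pmf p y * (u (x + y) - u x)) * (\<Prod>z\<in>A - {x}. u z))"
proof -
  define F where "F x z = (u z - u x) * (\<Prod>v\<in>A - {x}. u v)" for x z
  define Q where "Q = (\<Sum>x\<in>A. \<Sum>z\<in>A. pmf p (z - x) * F x z)"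
  have pair: "0 \<le> F x z + F z x" if "x \<in> A" "z \<in> A" for x z
  proof (cases "x = z")
    case False
    define R where "R = (\<Prod>v\<in>A - {x} - {z}. u v)"
    have "(\<Prod>v\<in>A - {x}. u v) = u z * R"
      unfolding R_def using that A False by (intro prod.remove) auto
    moreover have "(\<Prod>v\<in>A - {z}. u v) = u x * R"
      unfolding R_def using that A False
      by (subst prod.remove[of _ x]) (auto simp: Diff_insert2[symmetric] insert_commute)
    ultimately have "F x z + F z x = (u z - u x)\<^sup>2 * R"
      unfolding F_def by (simp add: power2_eq_square algebra_simps)
    moreover have "0 \<le> R" unfolding R_def using u by (intro prod_nonneg) auto
    ultimately show ?thesis by simp
  qed (simp add: F_def)
  have swap: "pmf p (x - z) = pmf p (z - x)" for x z
    using sym unfolding symmetric_law_def by (metis minus_diff_eq)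
  have "Q = (\<Sum>x\<in>A. \<Sum>z\<in>A. pmf p (x - z) * F z x)"
    unfolding Q_def by (rule sum.swap)
  also have "\<dots> = (\<Sum>x\<in>A. \<Sum>z\<in>A. pmf p (z - x) * F z x)"
    by (intro sum.cong refl arg_cong2[where f = "(*)"] swap)
  finally have Q_swap: "Q = (\<Sum>x\<in>A. \<Sum>z\<in>A. pmf p (z - x) * F z x)" .
  have "2 * Q = Q + Q" by simp
  also have "\<dots> = (\<Sum>x\<in>A. \<Sum>z\<in>A. pmf p (z - x) * (F x z + F z x))"
    unfolding distrib_left sum.distrib Q_def[symmetric] Q_swap[symmetric] by (rule refl)
  also have "\<dots> \<ge> 0"
    using pair by (intro sum_nonneg mult_nonneg_nonneg) auto
  finally have Q: "0 \<le> Q" by simp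
  have row: "(\<Sum>y\<in>set_pmf p. if x + y \<in> A then pmf p y * F x (x + y) else 0)
      = (\<Sum>z\<in>A. pmf p (z - x) * F x z)" for x
  proof -
    have "(\<Sum>y\<in>set_pmf p. if x + y \<in> A then pmf p y * F x (x + y) else 0)
        = (\<Sum>y\<in>{y \<in> set_pmf p. x + y \<in> A}. pmf p y * F x (x + y))"
      using fin by (simp add: sum.inter_filter)
    also have "\<dots> = (\<Sum>z\<in>{z \<in> A. z - x \<in> set_pmf p}. pmf p (z - x) * F x z)"
      by (rule sum.reindex_bij_witness[of _ "\<lambda>z. z - x" "\<lambda>y. x + y"]) auto
    also have "\<dots> = (\<Sum>z\<in>A. pmf p (z - x) * F x z)"
      using A by (intro sum.mono_neutral_left) (auto simp: set_pmf_iff)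
    finally show ?thesis .
  qed
  have cell: "(u (x + y) - u x) * (\<Prod>z\<in>A - {x}. u z) = F x (x + y)" for x y
    by (simp add: F_def)
  have jump: "(\<Prod>z\<in>insert (x + y) (A - {x}). u z) - (\<Prod>z\<in>A. u z) = F x (x + y)"
    if "x \<in> A" "x + y \<notin> A" for x y
    using that A prod.remove[OF A that(1), of u] by (simp add: F_def algebra_simps)
  have "(\<Sum>x\<in>A. (\<Sum>y\<in>set_pmf p. pmf p y * (u (x + y) - u x)) * (\<Prod>z\<in>A - {x}. u z))
      = (\<Sum>x\<in>A. \<Sum>y\<in>set_pmf p. pmf p y * F x (x + y))"
    by (simp add: sum_distrib_right cell mult.assoc)
  also have "\<dots> = (\<Sum>x\<in>A. \<Sum>y\<in>set_pmf p.
        (if x + y \<in> A then 0 else pmf p y * F x (x + y))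
      + (if x + y \<in> A then pmf p y * F x (x + y) else 0))"
    by (intro sum.cong refl) auto
  also have "\<dots> = (\<Sum>x\<in>A. \<Sum>y\<in>set_pmf p. if x + y \<in> A then 0 else pmf p y * F x (x + y)) + Q"
    unfolding sum.distrib Q_def row by simp
  also have "(\<Sum>x\<in>A. \<Sum>y\<in>set_pmf p. if x + y \<in> A then 0 else pmf p y * F x (x + y))
      = generator p (\<lambda>A. \<Prod>x\<in>A. u x) A"
    unfolding generator_eq[OF sym fin A] by (intro sum.cong refl) (auto simp: jump)
  finally show ?thesis using Q by simp
qed

text \<open>
  The total jump rate out of a configuration of \<open>n\<close> particles is at most \<open>n\<close>; this is the drift
  condition of the comparison principle.
\<close>

lemma generator_lower:
  fixes p :: "'a::ab_group_add pmf"
  assumes sym: "symmetric_law p" and fin: "finite (set_pmf p)" and A: "A \<in> configs n"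
    and h: "\<And>A. A \<in> configs n \<Longrightarrow> - B \<le> h A"
  shows "- real n * (B + h A) \<le> generator p h A"
proof -
  have fA: "finite A" "card A = n" using A by (auto simp: configs_def)
  have pos: "0 \<le> B + h A" using h[OF A] by simp
  have "- (B + h A) \<le> (\<Sum>y\<in>set_pmf p.
      if x + y \<in> A then 0 else pmf p y * (h (insert (x + y) (A - {x})) - h A))" if x: "x \<in> A" for x
  proof -
    have "- (B + h A) = (\<Sum>y\<in>set_pmf p. pmf p y * - (B + h A))"
      unfolding sum_distrib_right[symmetric] sum_pmf_eq_1[OF fin order_refl] by simp
    also have "\<dots> \<le> (\<Sum>y\<in>set_pmf p.
        if x + y \<in> A then 0 else pmf p y * (h (insert (x + y) (A - {x})) - h A))"
    proof (rule sum_mono)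
      fix y
      have "insert (x + y) (A - {x}) \<in> configs n" if "x + y \<notin> A"
      proof -
        have "card (insert (x + y) (A - {x})) = Suc (card (A - {x}))"
          using that fA by (intro card_insert_disjoint) auto
        then show ?thesis using card_Suc_Diff1[OF fA(1) x] fA by (simp add: configs_def)
      qed
      from h[OF this] have "- (B + h A) \<le> (if x + y \<in> A then 0 else h (insert (x + y) (A - {x})) - h A)"
        using pos by auto
      from mult_left_mono[OF this, of "pmf p y"]
      show "pmf p y * - (B + h A)
          \<le> (if x + y \<in> A then 0 else pmf p y * (h (insert (x + y) (A - {x})) - h A))"
        by (auto split: if_splits)
    qed
    finally show ?thesis .
  qed
  then have "(\<Sum>x\<in>A. - (B + h A)) \<le> generator p h A"
    unfolding generator_eq[OF sym fin fA(1)] by (intro sum_mono)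
  then show ?thesis by (simp add: fA algebra_simps)
qed

text \<open>
  By symmetry the forward equation is also the backward equation, so \<open>f\<close> can be compared with any
  supersolution. The function \<open>\<lambda>A. \<Prod>x\<in>A. u t x\<close> is one, where \<open>u\<close> solves the heat equation of a single
  particle with initial value \<open>g\<close> on \<open>Z\<close> and \<open>0\<close> elsewhere. At time \<open>0\<close> it vanishes at every configuration
  of \<open>n\<close> particles except \<open>Z\<close>, where it is the product of \<open>g\<close>. The weights \<open>g\<close> remain free,
  and the best choice of them is what brings in permutations later.
\<close>

lemma exclusion_le_product:
  fixes p :: "(int ^ 'd) pmf"
  assumes sym: "symmetric_law p" and l: "distinct l" "set l = set_pmf p"
    and Z: "Z \<in> configs n" and f: "forward_solution p n Z f"
    and g: "\<And>b. b \<in> Z \<Longrightarrow> 0 \<le> g b" and T: "0 \<le> T" and A: "A \<in> configs n"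
  shows "f T A * (\<Prod>b\<in>Z. g b) \<le> (\<Prod>x\<in>A. \<Sum>b\<in>Z. g b * step_kernel (pmf p) l T (x - b))"
proof -
  define c where "c = (\<Prod>b\<in>Z. g b)"
  define u where "u t x = (\<Sum>b\<in>Z. g b * step_kernel (pmf p) l t (x - b))" for t x
  define k where "k t A = (\<Prod>x\<in>A. u t x) - c * f t A" for t A
  define k' where "k' t A = (\<Sum>x\<in>A. (\<Sum>y\<in>set_pmf p. pmf p y * (u t (x + y) - u t x)) * (\<Prod>z\<in>A - {x}. u t z))
      - c * generator p (f t) A" for t A
  have fin: "finite (set_pmf p)" using l by (metis List.finite_set)
  have Zf: "finite Z" using Z by (simp add: configs_def)
  have c: "0 \<le> c" unfolding c_def using g by (intro prod_nonneg) auto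
  have neg: "- y \<in> set_pmf p \<longleftrightarrow> y \<in> set_pmf p" "pmf p (- y) = pmf p y" for y
    using sym by (simp_all add: symmetric_law_def set_pmf_iff)
  have u_nonneg: "0 \<le> u t x" if "0 \<le> t" for t x
    unfolding u_def using that g by (intro sum_nonneg mult_nonneg_nonneg kernel_nonneg) auto
  have u_0: "u 0 x = (if x \<in> Z then g x else 0)" for x
  proof -
    have "u 0 x = (\<Sum>b\<in>Z. if b = x then g b else 0)"
      unfolding u_def by (intro sum.cong refl) (auto simp: kernel_0)
    then show ?thesis using Zf by simp
  qed
  have du: "((\<lambda>s. u s x) has_real_derivative (\<Sum>y\<in>set_pmf p. pmf p y * (u t (x + y) - u t x))) (at t)" for t x
  proof -
    have "((\<lambda>s. u s x) has_real_derivative (\<Sum>b\<in>Z. g b *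
        (\<Sum>y\<leftarrow>l. pmf p y * (step_kernel (pmf p) l t (x - b - y) - step_kernel (pmf p) l t (x - b))))) (at t)"
      unfolding u_def by (intro DERIV_sum DERIV_cmult kernel_has_derivative)
    also have "(\<Sum>b\<in>Z. g b *
        (\<Sum>y\<leftarrow>l. pmf p y * (step_kernel (pmf p) l t (x - b - y) - step_kernel (pmf p) l t (x - b))))
      = (\<Sum>b\<in>Z. \<Sum>y\<in>set_pmf p. g b * (pmf p y * (step_kernel (pmf p) l t (x - b - y) - step_kernel (pmf p) l t (x - b))))"
      by (simp add: sum_list_distinct_conv_sum_set[OF l(1)] l(2) sum_distrib_left)
    also have "\<dots> = (\<Sum>y\<in>set_pmf p. \<Sum>b\<in>Z. g b * (pmf p y * (step_kernel (pmf p) l t (x - b - y) - step_kernel (pmf p) l t (x - b))))"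
      by (rule sum.swap)
    also have "\<dots> = (\<Sum>y\<in>set_pmf p. pmf p y * (u t (x - y) - u t x))"
      unfolding u_def sum_subtractf[symmetric] sum_distrib_left
      by (intro sum.cong refl) (simp add: algebra_simps)
    also have "\<dots> = (\<Sum>y\<in>set_pmf p. pmf p y * (u t (x + y) - u t x))"
      by (rule sum.reindex_bij_witness[of _ uminus uminus]) (auto simp: neg)
    finally show ?thesis .
  qed
  have fd: "((\<lambda>s. f s A) has_real_derivative generator p (f t) A) (at t within {0..})"
    if "0 \<le> t" "A \<in> configs n" for t A
    using f that unfolding forward_solution_def by blast
  obtain M where M: "\<And>t A. 0 \<le> t \<Longrightarrow> t \<le> T \<Longrightarrow> A \<in> configs n \<Longrightarrow> \<bar>f t A\<bar> \<le> M"
    using f T unfolding forward_solution_def by (meson atLeastAtMost_iff)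
  have "0 \<le> k T A"
  proof (rule comparison_principle[where k = k and k' = k' and S = "configs n" and c = "real n"
        and M = "c * M" and T = T])
    fix A :: "(int ^ 'd) set" assume A: "A \<in> configs n"
    then have fA: "finite A" by (simp add: configs_def)
    show "0 \<le> k 0 A"
    proof (cases "A = Z")
      case True
      then have "(\<Prod>x\<in>A. u 0 x) = c" unfolding c_def by (intro prod.cong) (auto simp: u_0)
      moreover have "f 0 A = 1" using f A True unfolding forward_solution_def by auto
      ultimately show ?thesis by (simp add: k_def)
    next
      case False
      then have "f 0 A = 0" using f A unfolding forward_solution_def by auto
      then show ?thesis unfolding k_def using u_nonneg by (auto intro: prod_nonneg)
    qed
    fix t :: real assume t: "0 \<le> t"
    show "((\<lambda>s. k s A) has_real_derivative k' t A) (at t within {0..})"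
      unfolding k_def k'_def
      by (intro DERIV_diff DERIV_cmult fd t A has_field_derivative_at_within[OF has_field_derivative_prod] du)
    show "- real n * (B + k t A) \<le> k' t A" if B: "\<And>A. A \<in> configs n \<Longrightarrow> - B \<le> k t A" for B
    proof -
      have "- real n * (B + k t A) \<le> generator p (k t) A"
        by (rule generator_lower[OF sym fin A B])
      also have "\<dots> = generator p (\<lambda>A. \<Prod>x\<in>A. u t x) A - c * generator p (f t) A"
        unfolding generator_eq[OF sym fin fA] sum_distrib_left sum_subtractf[symmetric]
        by (intro sum.cong refl) (simp add: k_def algebra_simps)
      also have "\<dots> \<le> k' t A"
        using generator_prod_le[OF sym fin fA u_nonneg[OF t]] by (simp add: k'_def)
      finally show ?thesis .
    qed
    assume "t \<le> T"
    then have "c * f t A \<le> c * M" using M[OF t _ A] c by (intro mult_left_mono) auto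
    moreover have "0 \<le> (\<Prod>x\<in>A. u t x)" using u_nonneg[OF t] by (intro prod_nonneg) auto
    ultimately show "- (c * M) \<le> k t A" by (simp add: k_def)
  qed (use T A in auto)
  then show ?thesis by (simp add: k_def c_def u_def mult.commute)
qed

section \<open>Off-diagonal decay of the heat kernel\<close>

lemma sinh_le_times_cosh:
  fixes x :: real
  assumes "0 \<le> x"
  shows "sinh x \<le> x * cosh x"
proof -
  have "(\<lambda>x. x * cosh x - sinh x) 0 \<le> (\<lambda>x::real. x * cosh x - sinh x) x"
  proof (rule DERIV_nonneg_imp_nondecreasing[OF assms])
    fix u :: real assume "0 \<le> u" "u \<le> x"
    moreover have "((\<lambda>x. x * cosh x - sinh x) has_real_derivative u * sinh u) (at u)"
      by (auto intro!: derivative_eq_intros)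
    ultimately show "\<exists>y. ((\<lambda>x. x * cosh x - sinh x) has_real_derivative y) (at u) \<and> 0 \<le> y"
      by (intro exI[of _ "u * sinh u"]) (simp add: sinh_real_nonneg_iff)
  qed
  then show ?thesis by simp
qed

lemma cosh_minus_one_le: "cosh x - 1 \<le> x\<^sup>2 / 2 * cosh x" for x :: real
proof -
  have "(\<lambda>x. x\<^sup>2 / 2 * cosh x - cosh x) 0 \<le> (\<lambda>x::real. x\<^sup>2 / 2 * cosh x - cosh x) \<bar>x\<bar>"
  proof (rule DERIV_nonneg_imp_nondecreasing[of 0 "\<bar>x\<bar>"])
    fix u :: real assume u: "0 \<le> u" "u \<le> \<bar>x\<bar>"
    have "((\<lambda>x. x\<^sup>2 / 2 * cosh x - cosh x) has_real_derivative
        (u * cosh u - sinh u) + u\<^sup>2 / 2 * sinh u) (at u)"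
      by (auto intro!: derivative_eq_intros)
    moreover have "0 \<le> (u * cosh u - sinh u) + u\<^sup>2 / 2 * sinh u"
      using sinh_le_times_cosh[OF u(1)] u by (intro add_nonneg_nonneg) (simp_all add: sinh_real_nonneg_iff)
    ultimately show "\<exists>y. ((\<lambda>x. x\<^sup>2 / 2 * cosh x - cosh x) has_real_derivative y) (at u) \<and> 0 \<le> y"
      by blast
  qed simp
  then show ?thesis by simp
qed

lemma cosh_le_cosh_abs: "\<bar>x\<bar> \<le> \<bar>w\<bar> \<Longrightarrow> cosh x \<le> cosh w" for x w :: real
  using cosh_real_nonneg_le_iff[of "\<bar>x\<bar>" "\<bar>w\<bar>"] by simp

text \<open>
  Symmetry removes the odd part of the exponential: the left-hand side is the mean of
  \<open>cosh (e y) - 1\<close>. This is where the function \<open>w\<^sup>2 * cosh w\<close> comes from.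
\<close>

lemma log_mgf_le:
  fixes p :: "(int ^ 'd) pmf" and e :: "int ^ 'd \<Rightarrow> real"
  assumes sym: "symmetric_law p" and fin: "finite (set_pmf p)"
    and e: "\<And>x. e (- x) = - e x" and w: "\<And>y. y \<in> set_pmf p \<Longrightarrow> \<bar>e y\<bar> \<le> \<bar>w\<bar>"
  shows "(\<Sum>y\<in>set_pmf p. pmf p y * (exp (e y) - 1)) \<le> w\<^sup>2 / 2 * cosh w"
proof -
  have neg: "- y \<in> set_pmf p \<longleftrightarrow> y \<in> set_pmf p" for y
    using sym by (simp add: symmetric_law_def set_pmf_iff)
  have "(\<Sum>y\<in>set_pmf p. pmf p y * (exp (e y) - 1)) = (\<Sum>y\<in>set_pmf p. pmf p y * (exp (- e y) - 1))"
    using sym by (intro sum.reindex_bij_witness[of _ uminus uminus]) (auto simp: neg e symmetric_law_def)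
  then have "2 * (\<Sum>y\<in>set_pmf p. pmf p y * (exp (e y) - 1))
      = (\<Sum>y\<in>set_pmf p. pmf p y * (exp (e y) - 1)) + (\<Sum>y\<in>set_pmf p. pmf p y * (exp (- e y) - 1))"
    by simp
  also have "\<dots> = (\<Sum>y\<in>set_pmf p. pmf p y * (2 * (cosh (e y) - 1)))"
    unfolding sum.distrib[symmetric] by (intro sum.cong refl) (simp add: cosh_field_def field_simps)
  also have "\<dots> \<le> (\<Sum>y\<in>set_pmf p. pmf p y * (2 * (w\<^sup>2 / 2 * cosh w)))"
  proof (intro sum_mono mult_left_mono)
    fix y assume y: "y \<in> set_pmf p"
    have "(e y)\<^sup>2 \<le> w\<^sup>2" using w[OF y] by (simp add: abs_le_square_iff)
    then have "(e y)\<^sup>2 / 2 * cosh (e y) \<le> w\<^sup>2 / 2 * cosh w"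
      using cosh_le_cosh_abs[OF w[OF y]] by (intro mult_mono) auto
    then show "cosh (e y) - 1 \<le> w\<^sup>2 / 2 * cosh w"
      using cosh_minus_one_le[of "e y"] by linarith
  qed auto
  also have "\<dots> = 2 * (w\<^sup>2 / 2 * cosh w)"
    using sum_pmf_eq_1[OF fin order_refl] by (simp only: sum_distrib_right[symmetric])
  finally show ?thesis by simp
qed

text \<open>
  The constant does not depend on the rates \<open>a\<close>, as long as for every step one of the two directions
  has at least its original rate. Every exponential tilt has this property, so the bound applies to
  all tilted walks at once.
\<close>

lemma kernel_sup_le:
  fixes p :: "(int ^ 'd) pmf"
  assumes irr: "irreducible_walk p" and sym: "symmetric_law p"
  obtains C where "0 < C"
    "\<And>a l T x. distinct l \<Longrightarrow> set l = set_pmf p \<Longrightarrow> 0 < T \<Longrightarrow>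
      (\<And>y. y \<in> set_pmf p \<Longrightarrow> 0 \<le> a y) \<Longrightarrow>
      (\<And>y. y \<in> set_pmf p \<Longrightarrow> pmf p y \<le> a y \<or> pmf p y \<le> a (- y)) \<Longrightarrow>
      step_kernel a l T x \<le> C / T powr (real CARD('d) / 2)"
proof -
  obtain b where b: "set b \<subseteq> set_pmf p" "independent_steps b" "length b = CARD('d)"
    by (rule exists_independent_steps[OF irr])
  define C where "C = (\<Prod>y\<leftarrow>b. exp 1 / sqrt (pmf p y))"
  have neg: "pmf p (- y) = pmf p y" for y
    using sym by (simp add: symmetric_law_def)
  have "0 < C" unfolding C_def using b(1)
    by (induction b) (auto intro!: mult_pos_pos divide_pos_pos simp: pmf_positive)
  moreover have "step_kernel a l T x \<le> C / T powr (real CARD('d) / 2)"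
    if l: "distinct l" "set l = set_pmf p" and T: "0 < T"
      and a: "\<And>y. y \<in> set_pmf p \<Longrightarrow> 0 \<le> a y"
      and flip: "\<And>y. y \<in> set_pmf p \<Longrightarrow> pmf p y \<le> a y \<or> pmf p y \<le> a (- y)" for a l T x
  proof -
    \<comment> \<open>orient each basis step in the direction whose rate did not decrease\<close>
    define s where "s y = (if pmf p y \<le> a y then y else - y)" for y
    define b' where "b' = map s b"
    define r where "r = filter (\<lambda>y. y \<notin> set b') l"
    define c where "c y = exp 1 / sqrt (pmf p y * T)" for y
    have pmf_s: "pmf p (s y) = pmf p y" for y by (simp add: s_def neg)
    have b'_sub: "set b' \<subseteq> set_pmf p"
      using b(1) by (auto simp: b'_def set_pmf_iff pmf_s)
    have ind: "independent_steps b'"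
      unfolding b'_def by (rule independent_steps_flip[OF b(2)]) (simp add: s_def)
    have "step_kernel a l T x = step_kernel a (r @ b') T x"
      using l a T b'_sub independent_steps_distinct[OF ind]
      by (intro kernel_cong_set) (auto simp: r_def)
    also have "\<dots> \<le> (\<Prod>y\<leftarrow>b'. c y)"
    proof (intro kernel_append_le kernel_le_independent ind)
      fix y k assume y: "y \<in> set b'"
      then obtain z where z: "z \<in> set_pmf p" "y = s z" using b(1) by (auto simp: b'_def)
      have p: "pmf p y \<le> a y" using flip[OF z(1)] by (auto simp: z s_def neg)
      have pos: "0 < pmf p y" using y b'_sub by (auto simp: pmf_positive)
      have "poisson_weight k (a y * T) \<le> exp 1 / sqrt (a y * T)"
        using p pos T by (intro poisson_weight_le) auto
      also have "\<dots> \<le> c y"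
        unfolding c_def using p pos T by (intro divide_left_mono) (auto intro!: mult_pos_pos)
      finally show "poisson_weight k (a y * T) \<le> c y" .
    qed (use T a b'_sub in \<open>auto simp: r_def l\<close>)
    also have "(\<Prod>y\<leftarrow>b'. c y) = C * (1 / sqrt T) ^ length b"
      unfolding b'_def C_def by (induction b) (simp_all add: c_def pmf_s real_sqrt_mult)
    also have "(1 / sqrt T) ^ length b = 1 / T powr (real CARD('d) / 2)"
      using T by (simp add: b(3) power_one_over powr_half_sqrt[symmetric] powr_power)
    finally show ?thesis by simp
  qed
  ultimately show ?thesis using that by blast
qed

text \<open>
  Tilt in the direction of \<open>v\<close> with strength \<open>w / K\<close>. The change of measure costs
  \<open>exp (T * w\<^sup>2 / 2 * cosh w)\<close> by \<open>log_mgf_le\<close> and gains \<open>exp (- w * norm v / K)\<close>, while the tilted kernel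
  still is of order \<open>T powr (- d / 2)\<close>. Optimizing over \<open>w\<close> gives the Legendre transform.
\<close>

lemma heat_kernel_bound:
  fixes p :: "(int ^ 'd) pmf"
  assumes irr: "irreducible_walk p" and sym: "symmetric_law p"
    and K: "0 < K" "\<And>y. y \<in> set_pmf p \<Longrightarrow> norm (real_vec y) \<le> K"
  obtains C where "0 < C"
    "\<And>l T v. distinct l \<Longrightarrow> set l = set_pmf p \<Longrightarrow> 0 < T \<Longrightarrow>
      step_kernel (pmf p) l T v \<le> C / T powr (real CARD('d) / 2) *
        exp (- (T / 2 * Phi (2 * norm (real_vec v) / (K * T))))"
proof -
  obtain C where C: "0 < C"
    "\<And>a l T x. distinct l \<Longrightarrow> set l = set_pmf p \<Longrightarrow> 0 < T \<Longrightarrow>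
      (\<And>y. y \<in> set_pmf p \<Longrightarrow> 0 \<le> a y) \<Longrightarrow>
      (\<And>y. y \<in> set_pmf p \<Longrightarrow> pmf p y \<le> a y \<or> pmf p y \<le> a (- y)) \<Longrightarrow>
      step_kernel a l T x \<le> C / T powr (real CARD('d) / 2)"
    using kernel_sup_le[OF irr sym] by blast
  have "step_kernel (pmf p) l T v \<le> C / T powr (real CARD('d) / 2) *
        exp (- (T / 2 * Phi (2 * norm (real_vec v) / (K * T))))"
    if l: "distinct l" "set l = set_pmf p" and T: "0 < T" for l T v
  proof -
    define k where "k = step_kernel (pmf p) l T v"
    define D where "D = C / T powr (real CARD('d) / 2)"
    define u where "u = 2 * norm (real_vec v) / (K * T)"
    have D: "0 < D" using C T by (simp add: D_def)
    have fin: "finite (set_pmf p)" using l by (metis List.finite_set)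
    have tilted: "k \<le> D * exp (- (T / 2 * (u * w - w\<^sup>2 * cosh w)))" for w
    proof -
      define e where "e x = w / K * (sgn (real_vec v) \<bullet> real_vec x)" for x
      have add: "e (x + y) = e x + e y" for x y
        by (simp add: e_def inner_add_right algebra_simps)
      have neg: "e (- x) = - e x" for x by (simp add: e_def)
      have ev: "e v = w / K * norm (real_vec v)"
        by (cases "real_vec v = 0")
          (simp_all add: e_def sgn_div_norm power2_norm_eq_inner[symmetric] power2_eq_square)
      have le: "\<bar>e y\<bar> \<le> \<bar>w\<bar>" if "y \<in> set_pmf p" for y
      proof -
        have "\<bar>sgn (real_vec v) \<bullet> real_vec y\<bar> \<le> norm (sgn (real_vec v)) * norm (real_vec y)"
          by (rule Cauchy_Schwarz_ineq2)
        also have "\<dots> \<le> 1 * K" using K(2)[OF that] by (intro mult_mono) (auto simp: norm_sgn)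
        finally have "\<bar>w\<bar> / K * \<bar>sgn (real_vec v) \<bullet> real_vec y\<bar> \<le> \<bar>w\<bar> / K * K"
          using K(1) by (intro mult_left_mono) auto
        then show ?thesis using K(1) by (simp add: e_def abs_mult)
      qed
      have "exp (e v) * k = exp (T * (\<Sum>y\<leftarrow>l. pmf p y * (exp (e y) - 1)))
          * step_kernel (\<lambda>y. pmf p y * exp (e y)) l T v"
        unfolding k_def by (rule kernel_tilt) (rule add)
      also have "\<dots> \<le> exp (T * (w\<^sup>2 / 2 * cosh w)) * D"
      proof (intro mult_mono)
        show "exp (T * (\<Sum>y\<leftarrow>l. pmf p y * (exp (e y) - 1))) \<le> exp (T * (w\<^sup>2 / 2 * cosh w))"
          using log_mgf_le[of p e w, OF sym fin neg le] T
          by (simp add: sum_list_distinct_conv_sum_set l)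
        show "step_kernel (\<lambda>y. pmf p y * exp (e y)) l T v \<le> D"
          unfolding D_def
        proof (rule C(2)[OF l T])
          fix y
          have "pmf p (- y) = pmf p y" using sym by (simp add: symmetric_law_def)
          moreover have "1 \<le> exp (e y) \<or> 1 \<le> exp (e (- y))" by (auto simp: neg)
          ultimately show "pmf p y \<le> pmf p y * exp (e y) \<or> pmf p y \<le> pmf p (- y) * exp (e (- y))"
            using mult_left_mono[of 1 _ "pmf p y"] by fastforce
        qed auto
        show "0 \<le> step_kernel (\<lambda>y. pmf p y * exp (e y)) l T v"
          using T by (intro kernel_nonneg) auto
      qed auto
      finally have "k \<le> D * (exp (T * (w\<^sup>2 / 2 * cosh w)) * exp (- e v))"
        by (simp add: exp_minus field_simps)
      also have "exp (T * (w\<^sup>2 / 2 * cosh w)) * exp (- e v) = exp (- (T / 2 * (u * w - w\<^sup>2 * cosh w)))"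
        using K(1) T by (simp add: ev u_def field_simps flip: exp_add)
      finally show ?thesis .
    qed
    show ?thesis
    proof (cases "k \<le> 0")
      case True
      then have "k \<le> D * exp (- (T / 2 * Phi u))"
        using D by (meson exp_ge_zero less_imp_le mult_nonneg_nonneg order.trans)
      then show ?thesis by (simp add: k_def D_def u_def)
    next
      case False
      \<comment> \<open>take logarithms, so that the supremum over \<open>w\<close> in \<open>Phi\<close> can be taken on the left\<close>
      have "Phi u \<le> - (2 / T) * ln (k / D)"
        unfolding Phi_def legendre_def
      proof (rule cSUP_least)
        fix w :: real
        have "k / D \<le> exp (- (T / 2 * (u * w - w\<^sup>2 * cosh w)))"
          using tilted[of w] D by (simp add: field_simps)
        then have "ln (k / D) \<le> ln (exp (- (T / 2 * (u * w - w\<^sup>2 * cosh w))))"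
          using False D by (subst ln_le_cancel_iff) auto
        then have "ln (k / D) \<le> - (T / 2 * (u * w - w\<^sup>2 * cosh w))"
          by (simp only: ln_exp)
        then show "u * w - w\<^sup>2 * cosh w \<le> - (2 / T) * ln (k / D)"
          using T by (simp add: field_simps)
      qed simp
      then have "ln (k / D) \<le> - (T / 2 * Phi u)"
        using T by (simp add: field_simps)
      then have "k / D \<le> exp (- (T / 2 * Phi u))"
        using False D by (metis divide_pos_pos exp_le_cancel_iff exp_ln not_le)
      then have "k \<le> D * exp (- (T / 2 * Phi u))"
        using D by (simp add: pos_divide_le_eq mult.commute)
      then show ?thesis by (simp only: k_def D_def u_def)
    qed
  qed
  with C(1) show ?thesis using that by blast
qed

section \<open>Optimal assignments\<close>

fun path_cost :: "('a \<Rightarrow> 'a \<Rightarrow> real) \<Rightarrow> 'a list \<Rightarrow> real" where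
  "path_cost w (x # y # r) = w x y + path_cost w (y # r)"
| "path_cost w _ = 0"

lemma path_cost_split: "path_cost w (as @ k # bs) = path_cost w (as @ [k]) + path_cost w (k # bs)"
proof (induction as)
  case (Cons a as)
  then show ?case by (cases as) auto
qed simp

lemma path_cost_snoc: "xs \<noteq> [] \<Longrightarrow> path_cost w (xs @ [k]) = path_cost w xs + w (last xs) k"
proof (induction xs)
  case (Cons a xs)
  then show ?case by (cases xs) auto
qed simp

lemma path_cost_rotate1:
  "xs \<noteq> [] \<Longrightarrow> (\<Sum>(i, j)\<leftarrow>zip xs (rotate1 xs). w i j) = path_cost w xs + w (last xs) (hd xs)"
proof -
  have "(\<Sum>(i, j)\<leftarrow>zip (x # r) (r @ [z]). w i j) = path_cost w (x # r) + w (last (x # r)) z" for x z r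
    by (induction r arbitrary: x) auto
  then show "xs \<noteq> [] \<Longrightarrow> ?thesis" by (cases xs) auto
qed

text \<open>
  A cycle without repeated vertices extends to a permutation that fixes all other vertices, where
  \<open>w\<close> vanishes.
\<close>

lemma cycle_cost_nonneg:
  assumes I: "finite I" and diag: "\<And>i. i \<in> I \<Longrightarrow> w i i = 0"
    and perm: "\<And>\<pi>. \<pi> permutes I \<Longrightarrow> 0 \<le> (\<Sum>i\<in>I. w i (\<pi> i))"
    and xs: "distinct xs" "xs \<noteq> []" "set xs \<subseteq> I"
  shows "0 \<le> path_cost w xs + w (last xs) (hd xs)"
proof -
  define \<pi> where "\<pi> = cycle_of_list xs"
  have "\<pi> permutes I"
    unfolding \<pi>_def using cycle_permutes xs(3) by (rule permutes_subset)
  then have "0 \<le> (\<Sum>i\<in>I. w i (\<pi> i))" by (rule perm)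
  also have "\<dots> = (\<Sum>i\<in>set xs. w i (\<pi> i))"
    using I xs(3) diag by (intro sum.mono_neutral_right) (auto simp: \<pi>_def id_outside_supp)
  also have "\<dots> = (\<Sum>i\<leftarrow>xs. w i (\<pi> i))"
    by (simp add: sum_list_distinct_conv_sum_set xs(1))
  also have "\<dots> = (\<Sum>(i, j)\<leftarrow>zip xs (map \<pi> xs). w i j)"
    by (simp add: zip_map2 zip_same_conv_map o_def)
  also have "map \<pi> xs = rotate1 xs"
    using cyclic_rotation[of xs 1] xs(1) by (simp add: \<pi>_def)
  finally show ?thesis by (simp add: path_cost_rotate1 xs(2))
qed

text \<open>
  The potential is the least cost of a path without repeated vertices that ends at \<open>j\<close>. Appending \<open>k\<close> to
  an optimal path to \<open>j\<close> gives a path to \<open>k\<close>, or closes a cycle if \<open>k\<close> was already visited; in the second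
  case the cycle can be cut off, since its cost is nonnegative.
\<close>

lemma exists_potential:
  fixes w :: "'a \<Rightarrow> 'a \<Rightarrow> real"
  assumes I: "finite I" and diag: "\<And>i. i \<in> I \<Longrightarrow> w i i = 0"
    and perm: "\<And>\<pi>. \<pi> permutes I \<Longrightarrow> 0 \<le> (\<Sum>i\<in>I. w i (\<pi> i))"
  obtains D where "\<And>i j. i \<in> I \<Longrightarrow> j \<in> I \<Longrightarrow> D j \<le> D i + w i j"
proof -
  define L where "L j = {xs. set xs \<subseteq> I \<and> distinct xs \<and> xs \<noteq> [] \<and> last xs = j}" for j
  define D where "D j = Min (path_cost w ` L j)" for j
  have finL: "finite (L j)" for j
    by (rule finite_subset[OF _ finite_subset_distinct[OF I]]) (auto simp: L_def)
  have D_le: "D j \<le> path_cost w xs" if "xs \<in> L j" for xs j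
    unfolding D_def using finL that by (intro Min_le) auto
  have "D k \<le> D j + w j k" if j: "j \<in> I" and k: "k \<in> I" for j k
  proof -
    have "[j] \<in> L j" using j by (simp add: L_def)
    then have "D j \<in> path_cost w ` L j"
      unfolding D_def using finL by (intro Min_in) auto
    then obtain xs where xs: "xs \<in> L j" "D j = path_cost w xs" by blast
    show ?thesis
    proof (cases "k \<in> set xs")
      case False
      then have "xs @ [k] \<in> L k" using xs(1) k by (simp add: L_def)
      from D_le[OF this] show ?thesis
        using xs by (simp add: path_cost_snoc L_def)
    next
      case True
      then obtain as bs where ab: "xs = as @ k # bs" by (meson split_list)
      have "as @ [k] \<in> L k" using xs(1) by (auto simp: L_def ab)
      from D_le[OF this] have "D k \<le> path_cost w (as @ [k])" .
      moreover have "0 \<le> path_cost w (k # bs) + w (last (k # bs)) (hd (k # bs))"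
        by (rule cycle_cost_nonneg[where w = w and I = I])
          (use xs(1) I diag perm in \<open>auto simp: L_def ab\<close>)
      moreover have "last (k # bs) = j" using xs(1) by (simp add: L_def ab)
      ultimately show ?thesis
        using xs(2) path_cost_split[of w as k bs] by (simp add: ab)
    qed
  qed
  then show ?thesis using that by blast
qed

text \<open>
  Linear programming duality for the assignment problem. Once the columns are relabelled by an optimal
  permutation, optimality says that no permutation has negative reduced cost, and a potential for the
  reduced costs yields the dual variables.
\<close>

lemma assignment_duality:
  fixes c :: "'a \<Rightarrow> 'a \<Rightarrow> real"
  assumes I: "finite I"
  obtains \<sigma> \<alpha> \<beta> where "\<sigma> permutes I"
    "\<And>i j. i \<in> I \<Longrightarrow> j \<in> I \<Longrightarrow> \<alpha> i + \<beta> j \<le> c i j"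
    "\<And>i. i \<in> I \<Longrightarrow> \<alpha> i + \<beta> (\<sigma> i) = c i (\<sigma> i)"
proof -
  define F where "F \<sigma> = (\<Sum>i\<in>I. c i (\<sigma> i))" for \<sigma>
  have "finite {\<sigma>. \<sigma> permutes I}" "{\<sigma>. \<sigma> permutes I} \<noteq> {}"
    using finite_permutations[OF I] permutes_id[of I] by blast+
  then obtain \<sigma> where \<sigma>: "\<sigma> permutes I" and min: "\<And>\<pi>. \<pi> permutes I \<Longrightarrow> F \<sigma> \<le> F \<pi>"
    using ex_is_arg_min_if_finite[of "{\<sigma>. \<sigma> permutes I}" F]
    unfolding is_arg_min_def by (auto simp: not_less)
  define w where "w i j = c i (\<sigma> j) - c i (\<sigma> i)" for i j
  obtain D where D: "\<And>i j. i \<in> I \<Longrightarrow> j \<in> I \<Longrightarrow> D j \<le> D i + w i j"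
  proof (rule exists_potential[OF I, of w])
    fix \<pi> assume "\<pi> permutes I"
    then have "F \<sigma> \<le> F (\<sigma> \<circ> \<pi>)" by (intro min permutes_compose \<sigma>)
    then show "0 \<le> (\<Sum>i\<in>I. w i (\<pi> i))" by (simp add: w_def F_def sum_subtractf)
  qed (auto simp: w_def)
  define \<beta> where "\<beta> j = D (inv \<sigma> j)" for j
  define \<alpha> where "\<alpha> i = c i (\<sigma> i) - D i" for i
  have "\<alpha> i + \<beta> j \<le> c i j" if "i \<in> I" "j \<in> I" for i j
    using D[OF that(1), of "inv \<sigma> j"] that permutes_inv[OF \<sigma>] permutes_inverses(1)[OF \<sigma>]
    by (simp add: \<alpha>_def \<beta>_def w_def permutes_in_image)
  moreover have "\<alpha> i + \<beta> (\<sigma> i) = c i (\<sigma> i)" for i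
    by (simp add: \<alpha>_def \<beta>_def permutes_inverses(2)[OF \<sigma>])
  ultimately show ?thesis using that[OF \<sigma>] by blast
qed

text \<open>
  The infimum over \<open>g\<close> of the left-hand side divided by \<open>\<Prod>i\<in>I. g i\<close> is the capacity of the matrix
  \<open>exp (- c i j)\<close> in the sense of Gurvits. Up to a factor that depends on the size only, it is
  the largest term of the permanent. With the dual variables \<open>\<alpha>\<close> and \<open>\<beta>\<close>, the weights
  \<open>g i = exp (\<alpha> i)\<close> make every entry of column \<open>j\<close> at most \<open>exp (- \<beta> j)\<close>.
\<close>

lemma capacity_le_permutation:
  fixes c :: "'a \<Rightarrow> 'a \<Rightarrow> real"
  assumes I: "finite I"
  obtains \<sigma> g where "\<sigma> permutes I" "\<And>i. 0 < g i"
    "(\<Prod>j\<in>I. \<Sum>i\<in>I. g i * exp (- c i j)) \<le> real (card I) ^ card I * exp (- (\<Sum>i\<in>I. c i (\<sigma> i))) * (\<Prod>i\<in>I. g i)"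
proof -
  obtain \<sigma> \<alpha> \<beta> where \<sigma>: "\<sigma> permutes I"
    and le: "\<And>i j. i \<in> I \<Longrightarrow> j \<in> I \<Longrightarrow> \<alpha> i + \<beta> j \<le> c i j"
    and eq: "\<And>i. i \<in> I \<Longrightarrow> \<alpha> i + \<beta> (\<sigma> i) = c i (\<sigma> i)"
    using assignment_duality[OF I] by blast
  have "(\<Prod>j\<in>I. \<Sum>i\<in>I. exp (\<alpha> i) * exp (- c i j)) \<le> (\<Prod>j\<in>I. real (card I) * exp (- \<beta> j))"
  proof (intro prod_mono conjI)
    fix j assume j: "j \<in> I"
    have "(\<Sum>i\<in>I. exp (\<alpha> i) * exp (- c i j)) \<le> (\<Sum>i\<in>I. exp (- \<beta> j))"
    proof (rule sum_mono)
      fix i assume "i \<in> I"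
      then have "\<alpha> i + - c i j \<le> - \<beta> j" using le[OF _ j] by (simp add: algebra_simps)
      then show "exp (\<alpha> i) * exp (- c i j) \<le> exp (- \<beta> j)"
        unfolding exp_add[symmetric] by (simp only: exp_le_cancel_iff)
    qed
    then show "(\<Sum>i\<in>I. exp (\<alpha> i) * exp (- c i j)) \<le> real (card I) * exp (- \<beta> j)" by simp
  qed (intro sum_nonneg, simp)
  also have "\<dots> = real (card I) ^ card I * exp (- (\<Sum>j\<in>I. \<beta> j))"
    by (simp add: prod.distrib exp_sum[OF I] flip: sum_negf)
  also have "(\<Sum>j\<in>I. \<beta> j) = (\<Sum>i\<in>I. \<beta> (\<sigma> i))"
    using sum.permute[OF \<sigma>, of \<beta>] by (simp add: o_def)
  also have "\<dots> = (\<Sum>i\<in>I. c i (\<sigma> i)) - (\<Sum>i\<in>I. \<alpha> i)"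
    unfolding sum_subtractf[symmetric] using eq by (intro sum.cong) (auto simp: algebra_simps)
  also have "exp (- ((\<Sum>i\<in>I. c i (\<sigma> i)) - (\<Sum>i\<in>I. \<alpha> i)))
      = exp (- (\<Sum>i\<in>I. c i (\<sigma> i))) * (\<Prod>i\<in>I. exp (\<alpha> i))"
    by (simp add: exp_diff exp_minus exp_sum[OF I] field_simps)
  finally show ?thesis
    using that[OF \<sigma>, of "\<lambda>i. exp (\<alpha> i)"] by (simp add: mult.assoc)
qed

section \<open>The estimate for exclusion particles\<close>

lemma Phi_upper: "u * w - w\<^sup>2 * cosh w \<le> Phi u"
  unfolding Phi_def legendre_def by (rule cSUP_upper[OF UNIV_I Phi_bdd_above])

text \<open>
  The decay of a product of one-particle kernels is governed by the Euclidean norm of the whole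
  displacement, with no loss that depends on the number of particles. For a given \<open>w\<close>, test the
  \<open>i\<close>th supremum with the multiple \<open>r i / R\<close> of \<open>w / (2 * L)\<close>, where \<open>R\<close> is the norm: the linear terms add
  up because \<open>\<Sum>i. (r i)\<^sup>2 = R\<^sup>2\<close>, and each \<open>cosh\<close> is at most \<open>cosh w\<close>. Dividing by \<open>L\<close>, which will be
  \<open>ln T\<close>, weakens the bound to the form in which it is stated.
\<close>

lemma Phi_superadditive:
  fixes r :: "'a \<Rightarrow> real"
  assumes I: "finite I" and K: "1 \<le> K" and L: "1 \<le> L" and T: "0 < T"
  shows "K * T / (2 * L\<^sup>2) * Phi (L2_set r I * L / (K\<^sup>2 * T)) \<le> (\<Sum>i\<in>I. T / 2 * Phi (2 * r i / (K * T)))"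
proof -
  define R where "R = L2_set r I"
  define S where "S = (\<Sum>i\<in>I. T / 2 * Phi (2 * r i / (K * T)))"
  have R2: "(\<Sum>i\<in>I. (r i)\<^sup>2) = R\<^sup>2"
    by (simp add: R_def L2_set_def sum_nonneg)
  have "Phi (R * L / (K\<^sup>2 * T)) \<le> 2 * L\<^sup>2 / (K * T) * S"
    unfolding Phi_def legendre_def
  proof (rule cSUP_least)
    fix w :: real
    define \<omega> where "\<omega> = w / (2 * L)"
    define v where "v i = \<omega> * (r i / R)" for i
    have \<omega>: "\<bar>\<omega>\<bar> \<le> \<bar>w\<bar>"
    proof -
      have "\<bar>w\<bar> / (2 * L) \<le> \<bar>w\<bar> / 1" using L by (intro divide_left_mono) auto
      then show ?thesis using L by (simp add: \<omega>_def)
    qed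
    \<comment> \<open>for \<open>R = 0\<close> all quotients are \<open>0\<close>, and the estimates below remain true\<close>
    have "(\<Sum>i\<in>I. (r i / R)\<^sup>2) = R\<^sup>2 / R\<^sup>2"
      by (simp add: power_divide R2 flip: sum_divide_distrib)
    then have unit: "(\<Sum>i\<in>I. (r i / R)\<^sup>2) \<le> 1" by simp
    have ratio: "\<bar>r i / R\<bar> \<le> 1" if "i \<in> I" for i
    proof -
      have "(r i / R)\<^sup>2 \<le> (\<Sum>i\<in>I. (r i / R)\<^sup>2)"
        using I that by (intro member_le_sum) auto
      with unit have "(r i / R)\<^sup>2 \<le> 1" by linarith
      then show ?thesis by (simp only: abs_square_le_1)
    qed
    have "(\<Sum>i\<in>I. (v i)\<^sup>2 * cosh (v i)) \<le> (\<Sum>i\<in>I. (\<omega>\<^sup>2 * cosh \<omega>) * (r i / R)\<^sup>2)"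
    proof (rule sum_mono)
      fix i assume "i \<in> I"
      then have "\<bar>v i\<bar> \<le> \<bar>\<omega>\<bar>"
        unfolding v_def abs_mult by (intro mult_left_le ratio) auto
      then have "(v i)\<^sup>2 * cosh (v i) \<le> (v i)\<^sup>2 * cosh \<omega>"
        by (intro mult_left_mono cosh_le_cosh_abs) auto
      also have "(v i)\<^sup>2 * cosh \<omega> = (\<omega>\<^sup>2 * cosh \<omega>) * (r i / R)\<^sup>2"
        unfolding v_def power_mult_distrib by (simp only: mult_ac)
      finally show "(v i)\<^sup>2 * cosh (v i) \<le> (\<omega>\<^sup>2 * cosh \<omega>) * (r i / R)\<^sup>2" .
    qed
    also have "\<dots> \<le> \<omega>\<^sup>2 * cosh \<omega>"
      unfolding sum_distrib_left[symmetric] using unit by (intro mult_left_le) auto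
    finally have cost: "(\<Sum>i\<in>I. (v i)\<^sup>2 * cosh (v i)) \<le> \<omega>\<^sup>2 * cosh \<omega>" .
    have "(\<Sum>i\<in>I. r i * v i) = \<omega> / R * (\<Sum>i\<in>I. (r i)\<^sup>2)"
      unfolding sum_distrib_left by (intro sum.cong refl) (simp add: v_def power2_eq_square)
    then have gain: "(\<Sum>i\<in>I. r i * v i) = \<omega> * R"
      unfolding R2 by (simp add: power2_eq_square)
    have "\<omega> * R / K - T / 2 * (\<omega>\<^sup>2 * cosh \<omega>)
        \<le> (\<Sum>i\<in>I. r i * v i) / K - T / 2 * (\<Sum>i\<in>I. (v i)\<^sup>2 * cosh (v i))"
      unfolding gain using cost T by (intro diff_mono mult_left_mono) auto
    also have "\<dots> = (\<Sum>i\<in>I. T / 2 * (2 * r i / (K * T) * v i - (v i)\<^sup>2 * cosh (v i)))"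
      unfolding sum_divide_distrib sum_distrib_left sum_subtractf[symmetric]
      using T K by (intro sum.cong refl) (simp add: field_simps)
    also have "\<dots> \<le> S"
      unfolding S_def using T by (intro sum_mono mult_left_mono Phi_upper) auto
    finally have "\<omega> * R / K - T / 2 * (\<omega>\<^sup>2 * cosh \<omega>) \<le> S" .
    moreover have "T / 2 * (\<omega>\<^sup>2 * cosh \<omega>) \<le> K * T / (2 * L\<^sup>2) * (w\<^sup>2 * cosh w)"
    proof -
      have "\<omega>\<^sup>2 * cosh \<omega> \<le> (w\<^sup>2 / (4 * L\<^sup>2)) * cosh w"
        using cosh_le_cosh_abs[OF \<omega>] by (intro mult_mono) (auto simp: \<omega>_def power_divide power_mult_distrib)
      also have "\<dots> \<le> K * (w\<^sup>2 / L\<^sup>2) * cosh w"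
      proof (intro mult_right_mono)
        have "w\<^sup>2 / (4 * L\<^sup>2) = 1 / 4 * (w\<^sup>2 / L\<^sup>2)" by simp
        also have "\<dots> \<le> K * (w\<^sup>2 / L\<^sup>2)" using K by (intro mult_right_mono) auto
        finally show "w\<^sup>2 / (4 * L\<^sup>2) \<le> K * (w\<^sup>2 / L\<^sup>2)" .
      qed auto
      finally have "T / 2 * (\<omega>\<^sup>2 * cosh \<omega>) \<le> T / 2 * (K * (w\<^sup>2 / L\<^sup>2) * cosh w)"
        using T by (intro mult_left_mono) auto
      then show ?thesis by (simp add: mult_ac)
    qed
    ultimately have "\<omega> * R / K - K * T / (2 * L\<^sup>2) * (w\<^sup>2 * cosh w) \<le> S" by linarith
    then have "2 * L\<^sup>2 / (K * T) * (\<omega> * R / K - K * T / (2 * L\<^sup>2) * (w\<^sup>2 * cosh w)) \<le> 2 * L\<^sup>2 / (K * T) * S"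
      using K T by (intro mult_left_mono) auto
    moreover have "2 * L\<^sup>2 / (K * T) * (\<omega> * R / K - K * T / (2 * L\<^sup>2) * (w\<^sup>2 * cosh w))
        = R * L / (K\<^sup>2 * T) * w - w\<^sup>2 * cosh w"
      using K L T by (simp add: \<omega>_def field_simps power2_eq_square)
    ultimately show "R * L / (K\<^sup>2 * T) * w - w\<^sup>2 * cosh w \<le> 2 * L\<^sup>2 / (K * T) * S" by simp
  qed simp
  then have "K * T / (2 * L\<^sup>2) * Phi (R * L / (K\<^sup>2 * T)) \<le> K * T / (2 * L\<^sup>2) * (2 * L\<^sup>2 / (K * T) * S)"
    using K T by (intro mult_left_mono) auto
  also have "\<dots> = S" using K L T by (simp add: field_simps)
  finally show ?thesis by (simp add: R_def S_def)
qed

lemma tuple_dist_eq: "tuple_dist n x z = L2_set (\<lambda>i. norm (real_vec (x i - z i))) {1..n}"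
proof -
  have "(\<chi> j. real_of_int (x i $ j) - real_of_int (z i $ j)) = real_vec (x i - z i)" for i
    by (simp add: real_vec_def vec_eq_iff)
  then show ?thesis by (simp add: tuple_dist_def)
qed

theorem theorem1p1:
  fixes p :: "(int ^ 'd) pmf"
  assumes "finite_range p" and "irreducible_walk p" and "symmetric_law p"
  shows "\<exists>a0::real. a0 > 0 \<and> (\<forall>n::nat. n \<ge> 2 \<longrightarrow> (\<exists>C2::real. C2 \<ge> 1 \<and>
    (\<forall>z f. inj_on z {1..n} \<longrightarrow> forward_solution p n (z ` {1..n}) f \<longrightarrow>
      (\<forall>T x. T > C2 \<longrightarrow> inj_on x {1..n} \<longrightarrow>
        f T (x ` {1..n}) \<le>
          (\<Sum>\<sigma> | \<sigma> permutes {1..n}.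
            C2 / (1 + T) powr (real n * real CARD('d) / 2) *
            exp (- (a0 * T / (2 * (ln T)\<^sup>2) *
              Phi (tuple_dist n (x \<circ> \<sigma>) z * ln T / (a0\<^sup>2 * T)))))))))"
proof -
  have fin: "finite (set_pmf p)" using assms(1) by (simp add: finite_range_def)
  obtain l where l: "set l = set_pmf p" "distinct l"
    using finite_distinct_list[OF fin] by blast
  define K where "K = Max (insert 1 ((\<lambda>y. norm (real_vec y)) ` set_pmf p))"
  have K: "1 \<le> K" "\<And>y. y \<in> set_pmf p \<Longrightarrow> norm (real_vec y) \<le> K"
    unfolding K_def using fin by (auto intro!: Max_ge)
  have K0: "0 < K" using K(1) by simp
  obtain C where C: "0 < C"
    and bound: "\<And>l T v. distinct l \<Longrightarrow> set l = set_pmf p \<Longrightarrow> 0 < T \<Longrightarrow>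
      step_kernel (pmf p) l T v \<le> C / T powr (real CARD('d) / 2) *
        exp (- (T / 2 * Phi (2 * norm (real_vec v) / (K * T))))"
    using heat_kernel_bound[OF assms(2,3) K0 K(2)] by blast
  show ?thesis
  proof (rule exI[of _ K], rule conjI[OF K0], intro allI impI)
    fix n :: nat assume "2 \<le> n"
    define I where "I = {1..n}"
    define q where "q = real n * real CARD('d) / 2"
    \<comment> \<open>\<open>exp 1\<close> gives \<open>1 \<le> ln T\<close>; \<open>2 powr q\<close> pays for replacing \<open>T\<close> by \<open>1 + T\<close>\<close>
    define C2 where "C2 = max (exp 1) (real n ^ n * C ^ n * 2 powr q)"
    have fI: "finite I" and cI: "card I = n" by (auto simp: I_def)
    have C2: "1 \<le> C2" by (simp add: C2_def le_max_iff_disj)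
    have main: "f T (x ` I) \<le> (\<Sum>\<sigma> | \<sigma> permutes I. C2 / (1 + T) powr q *
            exp (- (K * T / (2 * (ln T)\<^sup>2) * Phi (tuple_dist n (x \<circ> \<sigma>) z * ln T / (K\<^sup>2 * T)))))"
      if z: "inj_on z I" and f: "forward_solution p n (z ` I) f" and T: "C2 < T" and x: "inj_on x I"
      for z f T x
    proof -
      have T1: "exp 1 < T" "real n ^ n * C ^ n * 2 powr q < T" "1 < T"
        using T C2 by (auto simp: C2_def)
      have L: "1 \<le> ln T" using T1 by (simp add: ln_ge_iff)
      define D where "D = C / T powr (real CARD('d) / 2)"
      define c where "c i j = T / 2 * Phi (2 * norm (real_vec (x j - z i)) / (K * T))" for i j
      have D: "0 < D" using C T1 by (simp add: D_def)
      obtain \<sigma> g where \<sigma>: "\<sigma> permutes I" and g: "\<And>i. 0 < g i"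
        and cap: "(\<Prod>j\<in>I. \<Sum>i\<in>I. g i * exp (- c i j))
          \<le> real (card I) ^ card I * exp (- (\<Sum>i\<in>I. c i (\<sigma> i))) * (\<Prod>i\<in>I. g i)"
        using capacity_le_permutation[OF fI, of c] by blast
      define G where "G = (\<Prod>i\<in>I. g i)"
      \<comment> \<open>the weights, transported from indices to the sites that are initially occupied\<close>
      define gz where "gz b = g (inv_into I z b)" for b
      have gz: "gz (z i) = g i" if "i \<in> I" for i by (simp add: gz_def inv_into_f_f[OF z that])
      have G: "0 < G" unfolding G_def using g by (intro prod_pos) auto
      have "f T (x ` I) * (\<Prod>b\<in>z ` I. gz b)
          \<le> (\<Prod>y\<in>x ` I. \<Sum>b\<in>z ` I. gz b * step_kernel (pmf p) l T (y - b))"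
        by (rule exclusion_le_product[where n = n and p = p, OF assms(3) l(2,1) _ f])
          (use T1 g x z in \<open>auto simp: configs_def fI cI card_image gz_def less_imp_le\<close>)
      also have "\<dots> = (\<Prod>j\<in>I. \<Sum>i\<in>I. g i * step_kernel (pmf p) l T (x j - z i))"
        by (simp add: prod.reindex[OF x] sum.reindex[OF z] gz)
      also have "\<dots> \<le> (\<Prod>j\<in>I. D * (\<Sum>i\<in>I. g i * exp (- c i j)))"
      proof (intro prod_mono conjI)
        fix j
        show "0 \<le> (\<Sum>i\<in>I. g i * step_kernel (pmf p) l T (x j - z i))"
          using g T1 by (intro sum_nonneg mult_nonneg_nonneg kernel_nonneg) (auto simp: less_imp_le)
        have "g i * step_kernel (pmf p) l T (x j - z i) \<le> D * (g i * exp (- c i j))" for i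
          using mult_left_mono[OF bound[OF l(2,1), of T "x j - z i"], of "g i"] T1 g[of i]
          by (simp add: D_def c_def mult_ac)
        then show "(\<Sum>i\<in>I. g i * step_kernel (pmf p) l T (x j - z i)) \<le> D * (\<Sum>i\<in>I. g i * exp (- c i j))"
          unfolding sum_distrib_left by (intro sum_mono)
      qed
      also have "\<dots> = D ^ n * (\<Prod>j\<in>I. \<Sum>i\<in>I. g i * exp (- c i j))"
        by (simp add: prod.distrib cI)
      also have "\<dots> \<le> D ^ n * (real n ^ n * exp (- (\<Sum>i\<in>I. c i (\<sigma> i))) * G)"
        using cap D by (intro mult_left_mono) (auto simp: cI G_def)
      finally have "f T (x ` I) * G \<le> (D ^ n * real n ^ n * exp (- (\<Sum>i\<in>I. c i (\<sigma> i)))) * G"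
        by (simp add: prod.reindex[OF z] gz G_def mult_ac)
      then have f_le: "f T (x ` I) \<le> D ^ n * real n ^ n * exp (- (\<Sum>i\<in>I. c i (\<sigma> i)))"
        using G by (simp only: mult_le_cancel_right_pos)
      have "K * T / (2 * (ln T)\<^sup>2) * Phi (tuple_dist n (x \<circ> \<sigma>) z * ln T / (K\<^sup>2 * T)) \<le> (\<Sum>i\<in>I. c i (\<sigma> i))"
        using Phi_superadditive[OF fI K(1) L, of T "\<lambda>i. norm (real_vec (x (\<sigma> i) - z i))"] T1
        by (simp add: tuple_dist_eq c_def I_def del: real_vec_simps)
      then have expo: "exp (- (\<Sum>i\<in>I. c i (\<sigma> i)))
          \<le> exp (- (K * T / (2 * (ln T)\<^sup>2) * Phi (tuple_dist n (x \<circ> \<sigma>) z * ln T / (K\<^sup>2 * T))))"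
        by simp
      have pref: "D ^ n * real n ^ n \<le> C2 / (1 + T) powr q"
      proof -
        have Dn: "D ^ n = C ^ n / T powr q"
          using T1 by (simp add: D_def power_divide q_def powr_power mult_ac)
        have "(1 + T) powr q \<le> 2 powr q * T powr q"
          using T1 by (subst powr_mult[symmetric]) (auto intro!: powr_mono2 simp: q_def)
        then have "real n ^ n * C ^ n * (1 + T) powr q \<le> real n ^ n * C ^ n * (2 powr q * T powr q)"
          using C by (intro mult_left_mono) auto
        also have "\<dots> \<le> C2 * T powr q"
          unfolding mult.assoc[symmetric] by (intro mult_right_mono) (auto simp: C2_def)
        finally have "real n ^ n * C ^ n / T powr q \<le> C2 / (1 + T) powr q"
          using T1 by (simp add: divide_simps)
        then show ?thesis by (simp add: Dn mult_ac)
      qed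
      have "D ^ n * real n ^ n * exp (- (\<Sum>i\<in>I. c i (\<sigma> i))) \<le> C2 / (1 + T) powr q *
          exp (- (K * T / (2 * (ln T)\<^sup>2) * Phi (tuple_dist n (x \<circ> \<sigma>) z * ln T / (K\<^sup>2 * T))))"
        using C2 by (intro mult_mono pref expo) auto
      also have "\<dots> \<le> (\<Sum>\<sigma> | \<sigma> permutes I. C2 / (1 + T) powr q *
          exp (- (K * T / (2 * (ln T)\<^sup>2) * Phi (tuple_dist n (x \<circ> \<sigma>) z * ln T / (K\<^sup>2 * T)))))"
        by (rule member_le_sum[of \<sigma>]) (use \<sigma> finite_permutations[OF fI] C2 in auto)
      finally show ?thesis using f_le by linarith
    qed
    show "\<exists>C2::real. C2 \<ge> 1 \<and>
      (\<forall>z f. inj_on z {1..n} \<longrightarrow> forward_solution p n (z ` {1..n}) f \<longrightarrow>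
        (\<forall>T x. T > C2 \<longrightarrow> inj_on x {1..n} \<longrightarrow>
          f T (x ` {1..n}) \<le>
            (\<Sum>\<sigma> | \<sigma> permutes {1..n}.
              C2 / (1 + T) powr (real n * real CARD('d) / 2) *
              exp (- (K * T / (2 * (ln T)\<^sup>2) *
                Phi (tuple_dist n (x \<circ> \<sigma>) z * ln T / (K\<^sup>2 * T)))))))"
      using C2 main unfolding I_def q_def by blast
  qed
qed

end
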